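(* Let $\rho\in(0,1)$ and $\delta_1\in(0,1)$, and let $v_N=((1-\rho)^2N,\rho^2N)$. (1) There exist positive constants $C,c,N_0$ depending only on $\delta_1,\rho$ such that for all $N\ge N_0$ and all $y$ with $0<y<\delta_1N^{2/3}$, $$\mathbb{P}^\rho\left(G^1_{\mathrm{stat}}(v_N)-N\ge yN^{1/3}\right)\le Ce^{-cy^{3/2}}.$$ (2) There exist positive constants $C,c,N_0$ depending only on $\delta_1,\rho$ such that for all $N\ge N_0$ and all $y$ with $0<y<\delta_1N^{2/3}$, $$\mathbb{P}^\rho\left(G^1_{\mathrm{stat}}(v_N)-N\ge yN^{1/3}\right)\ge Ce^{-cy^{3/2}}.$$
   Context: Boundary representation of stationary LPP with density $\rho\in(0,1)$: let $\mathrm e_1=(1,0)$, $\mathrm e_2=(0,1)$, $\mathbf 0=(0,0)$. Let $\omega'=\{\omega'_v:v\in\mathbb{Z}^2_{\ge0}\}$ be independent with $\omega'_{\mathbf 0}=0$, $\omega'_v\sim\mathrm{exp}(1)$ for $v\in\mathbb{Z}^2_{>0}$, $\omega'_{i\mathrm e_1}\sim\mathrm{exp}(1-\rho)$ and $\omega'_{j\mathrm e_2}\sim\mathrm{exp}(\rho)$ for $i,j\ge1$, where $\mathrm{exp}(\lambda)$ is the exponential law with rate $\lambda$ (mean $1/\lambda$). Probabilities for this model are denoted $\mathbb{P}^\rho$. An up-right path is a lattice path with steps $\mathrm e_1,\mathrm e_2$; the weight of a path is the sum of the $\omega'$ over all its vertices (including endpoints). For $v\in\mathbb{Z}^2_{\ge0}$,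 $G^1_{\mathrm{stat}}(v)$ is the maximum weight over all up-right paths from $\mathbf 0$ to $v$. Rounding convention: non-integer coordinates are rounded to integers (e.g. by taking the floor); $N$ is a positive integer. *)

theory Defs
  imports "HOL-Probability.Probability"
begin

type_synonym vertex = "nat \<times> nat"

abbreviation exp_law :: "real \<Rightarrow> real measure" where
  "exp_law l \<equiv> density lborel (\<lambda>x. ennreal (exponential_density l x))"

definition weight_law :: "real \<Rightarrow> vertex \<Rightarrow> real measure" where
  "weight_law \<rho> v =
     (if v = (0, 0) then return borel 0
      else if snd v = 0 then exp_law (1 - \<rho>)
      else if fst v = 0 then exp_law \<rho>
      else exp_law 1)"

text \<open>The measure \<open>\<bbbP>\<^sup>\<rho>\<close>, realised canonically as the joint law of the weights
  \<open>\<omega>'\<close>. The weights are the coordinates; the lemmas \<open>distr_weight\<close> and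
  \<open>indep_vars_weight\<close> below confirm their marginals and their independence.\<close>

definition stat_measure :: "real \<Rightarrow> (vertex \<Rightarrow> real) measure" where
  "stat_measure \<rho> = (\<Pi>\<^sub>M v\<in>UNIV. weight_law \<rho> v)"

definition up_right_path :: "vertex list \<Rightarrow> bool" where
  "up_right_path \<pi> \<longleftrightarrow> \<pi> \<noteq> [] \<and>
     successively (\<lambda>p q. q = p + (1, 0) \<or> q = p + (0, 1)) \<pi>"

definition up_right_paths :: "vertex \<Rightarrow> vertex \<Rightarrow> vertex list set" where
  "up_right_paths u v = {\<pi>. up_right_path \<pi> \<and> hd \<pi> = u \<and> last \<pi> = v}"

definition path_weight :: "(vertex \<Rightarrow> real) \<Rightarrow> vertex list \<Rightarrow> real" where
  "path_weight \<omega> \<pi> = (\<Sum>v\<leftarrow>\<pi>. \<omega> v)"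

definition G_stat :: "(vertex \<Rightarrow> real) \<Rightarrow> vertex \<Rightarrow> real" where
  "G_stat \<omega> v = Max (path_weight \<omega> ` up_right_paths (0, 0) v)"

text \<open>Non-integer coordinates are rounded down.\<close>

definition char_point :: "real \<Rightarrow> nat \<Rightarrow> vertex" where
  "char_point \<rho> N = (nat \<lfloor>(1 - \<rho>)\<^sup>2 * real N\<rfloor>, nat \<lfloor>\<rho>\<^sup>2 * real N\<rfloor>)"


lemma sets_weight_law [simp, measurable_cong]: "sets (weight_law \<rho> v) = sets borel"
  by (simp add: weight_law_def)

lemma prob_space_weight_law:
  assumes "0 < \<rho>" "\<rho> < 1"
  shows "prob_space (weight_law \<rho> v)"
  using assms
  by (auto simp: weight_law_def intro!: prob_space_return prob_space_exponential_density)

lemma product_prob_space_weight_law: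
  assumes "0 < \<rho>" "\<rho> < 1"
  shows "product_prob_space (weight_law \<rho>)"
proof -
  interpret prob_space "weight_law \<rho> v" for v
    by (rule prob_space_weight_law[OF assms])
  show ?thesis by unfold_locales
qed

lemma prob_space_stat_measure:
  assumes "0 < \<rho>" "\<rho> < 1"
  shows "prob_space (stat_measure \<rho>)"
  unfolding stat_measure_def by (intro prob_space_PiM prob_space_weight_law assms)

lemma space_stat_measure [simp]: "space (stat_measure \<rho>) = UNIV"
  using sets_eq_imp_space_eq[OF sets_weight_law]
  by (simp add: stat_measure_def space_PiM PiE_UNIV_domain)

lemma measurable_weight [measurable]:
  "(\<lambda>\<omega>. \<omega> v) \<in> borel_measurable (stat_measure \<rho>)"
proof -
  have "(\<lambda>\<omega>. \<omega> v) \<in> measurable (stat_measure \<rho>) (weight_law \<rho> v)"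
    unfolding stat_measure_def by (rule measurable_component_singleton) simp
  then show ?thesis
    using measurable_cong_sets[OF refl sets_weight_law] by blast
qed

lemma distr_weight:
  assumes "0 < \<rho>" "\<rho> < 1"
  shows "distr (stat_measure \<rho>) borel (\<lambda>\<omega>. \<omega> v) = weight_law \<rho> v"
proof -
  interpret product_prob_space "weight_law \<rho>" UNIV
    by (rule product_prob_space_weight_law[OF assms])
  have "distr (stat_measure \<rho>) (weight_law \<rho> v) (\<lambda>\<omega>. \<omega> v) = weight_law \<rho> v"
    unfolding stat_measure_def by (rule PiM_component) simp
  moreover have "distr (stat_measure \<rho>) (weight_law \<rho> v) (\<lambda>\<omega>. \<omega> v)
      = distr (stat_measure \<rho>) borel (\<lambda>\<omega>. \<omega> v)"
    by (rule distr_cong) auto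
  ultimately show ?thesis by simp
qed

lemma indep_vars_weight:
  assumes "0 < \<rho>" "\<rho> < 1"
  shows "prob_space.indep_vars (stat_measure \<rho>) (\<lambda>_. borel) (\<lambda>v \<omega>. \<omega> v) UNIV"
proof -
  interpret prob_space "stat_measure \<rho>"
    by (rule prob_space_stat_measure[OF assms])
  have S: "sets (\<Pi>\<^sub>M v\<in>UNIV. (borel :: real measure)) = sets (stat_measure \<rho>)"
    unfolding stat_measure_def by (rule sets_PiM_cong) auto
  have "distr (stat_measure \<rho>) (\<Pi>\<^sub>M v\<in>UNIV. borel) (\<lambda>\<omega>. \<lambda>v\<in>UNIV. \<omega> v)
      = distr (stat_measure \<rho>) (stat_measure \<rho>) (\<lambda>\<omega>. \<omega>)"
    by (rule distr_cong) (auto simp: S)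
  also have "\<dots> = stat_measure \<rho>"
    by (rule distr_id2) simp
  also have "\<dots> = (\<Pi>\<^sub>M v\<in>UNIV. distr (stat_measure \<rho>) borel (\<lambda>\<omega>. \<omega> v))"
    by (simp add: distr_weight[OF assms]) (simp add: stat_measure_def)
  finally show ?thesis
    by (subst indep_vars_iff_distr_eq_PiM') auto
qed

text \<open>The maximum in \<open>G_stat\<close> is over a finite nonempty set.\<close>

lemma up_right_path_mono:
  assumes "up_right_path \<pi>"
  shows "length \<pi> + fst (hd \<pi>) + snd (hd \<pi>) = Suc (fst (last \<pi>) + snd (last \<pi>)) \<and>
    set \<pi> \<subseteq> {..fst (last \<pi>)} \<times> {..snd (last \<pi>)}"
  using assms
proof (induction \<pi>)
  case Nil
  then show ?case by (simp add: up_right_path_def)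
next
  case (Cons a \<pi>)
  show ?case
  proof (cases \<pi>)
    case Nil
    then show ?thesis by (cases a) simp
  next
    case (Cons b \<pi>')
    with Cons.prems have "up_right_path \<pi>" and ab: "b = a + (1, 0) \<or> b = a + (0, 1)"
      by (auto simp: up_right_path_def)
    with Cons.IH have IH: "length \<pi> + fst (hd \<pi>) + snd (hd \<pi>) = Suc (fst (last \<pi>) + snd (last \<pi>))"
      "set \<pi> \<subseteq> {..fst (last \<pi>)} \<times> {..snd (last \<pi>)}" by auto
    moreover have "hd \<pi> = b" "b \<in> set \<pi>" "last (a # \<pi>) = last \<pi>"
      using Cons by auto
    moreover have "fst b \<le> fst (last \<pi>)" "snd b \<le> snd (last \<pi>)"
      using IH(2) \<open>b \<in> set \<pi>\<close> by (auto simp: mem_Times_iff dest!: subsetD)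
    ultimately show ?thesis
      using ab by (cases a) (auto simp: mem_Times_iff)
  qed
qed

lemma finite_up_right_paths: "finite (up_right_paths u v)"
proof (rule finite_subset)
  show "up_right_paths u v \<subseteq>
      {\<pi>. set \<pi> \<subseteq> {..fst v} \<times> {..snd v} \<and> length \<pi> \<le> Suc (fst v + snd v)}"
    using up_right_path_mono by (fastforce simp: up_right_paths_def)
  show "finite {\<pi>. set \<pi> \<subseteq> {..fst v} \<times> {..snd v} \<and> length \<pi> \<le> Suc (fst v + snd v)}"
    by (rule finite_lists_length_le) simp
qed

lemma up_right_paths_snoc:
  assumes "\<pi> \<in> up_right_paths u v" "w = v + (1, 0) \<or> w = v + (0, 1)"
  shows "\<pi> @ [w] \<in> up_right_paths u w"
  using assms by (auto simp: up_right_paths_def up_right_path_def successively_append_iff)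

lemma up_right_paths_nonempty: "up_right_paths (0, 0) v \<noteq> {}"
proof -
  have x: "up_right_paths (0, 0) (i, 0) \<noteq> {}" for i
  proof (induction i)
    case 0
    have "[(0, 0)] \<in> up_right_paths (0, 0) (0, 0)"
      by (simp add: up_right_paths_def up_right_path_def)
    then show ?case by blast
  next
    case (Suc i)
    then show ?case using up_right_paths_snoc[of _ _ "(i, 0)" "(Suc i, 0)"] by fastforce
  qed
  have "up_right_paths (0, 0) (i, j) \<noteq> {}" for i j
  proof (induction j)
    case 0
    then show ?case by (rule x)
  next
    case (Suc j)
    then show ?case using up_right_paths_snoc[of _ _ "(i, j)" "(i, Suc j)"] by fastforce
  qed
  then show ?thesis by (cases v) auto
qed

lemma measurable_G_stat [measurable]:
  "(\<lambda>\<omega>. G_stat \<omega> v) \<in> borel_measurable (stat_measure \<rho>)"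
proof -
  have "path_weight \<omega> \<pi> = (\<Sum>i<length \<pi>. \<omega> (\<pi> ! i))" for \<omega> \<pi>
    by (simp add: path_weight_def sum_list_sum_nth atLeast0LessThan)
  then have "(\<lambda>\<omega>. path_weight \<omega> \<pi>) \<in> borel_measurable (stat_measure \<rho>)" for \<pi>
    by simp
  then show ?thesis
    unfolding G_stat_def
    by (intro borel_measurable_Max finite_up_right_paths)
qed

end

theory Submission
  imports Defs
begin

text \<open>
  Both estimates follow from exponential moments of the last-passage time, which are available in
  closed form for a one-parameter perturbation of the boundary. Let the weights on the horizontal
  axis have rate \<open>a\<close>, those on the vertical axis rate \<open>b\<close>, and those in the bulk rate \<open>1\<close>. For
  \<open>a\<close>, \<open>b\<close> in \<open>(0, 1)\<close>,
  \<open>E exp ((a + b - 1) G(m, n)) = (a / (1 - b)) ^ m * (b / (1 - a)) ^ n\<close>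
  (\<open>nn_integral_exp_G_stat\<close>). If \<open>a + b = 1\<close>, the increments of \<open>G\<close> along every vertical line are
  independent of rate \<open>b\<close> (Burke's property); tilting the weights of the horizontal axis by
  \<open>exp (\<theta> x)\<close> turns the rate \<open>a\<close> into \<open>a - \<theta> = 1 - b\<close>, so that the tilted model is of this kind.
  Burke's property is obtained by flipping one lattice corner at a time: a flip preserves the law
  of the weights (\<open>nn_integral_corner_flip\<close>), and sweeping through the rectangle carries the
  vertical axis to the line through \<open>m\<close>.

  The stationary model of density \<open>\<rho>\<close> is compared with two such perturbations, of parameter
  \<open>a + b - 1 = \<theta>\<close>, by shrinking the weights of one of the axes. Shrinking can only lower \<open>G\<close>, and
  since a path follows only one of the two axes, \<open>G\<close> is at most the larger of the two shrunk
  passage times. At the characteristic point the first and second order terms of the exponent are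
  \<open>N \<theta>\<close> and \<open>0\<close>, hence, up to constant factors,
  \<open>exp (N \<theta>\<^sup>3 / 3) \<le> E exp (\<theta> (G - N)) \<le> exp (B N \<theta>\<^sup>3)\<close> with \<open>B = 1 / \<rho> + 1 / (1 - \<rho>)\<close>
  (\<open>moment_bounds\<close>).

  Now write \<open>N = r\<^sup>3\<close> and \<open>y = u\<^sup>2\<close> and take \<open>\<theta>\<close> proportional to \<open>u / r\<close>, so that both \<open>\<theta> y r\<close> and
  \<open>N \<theta>\<^sup>3\<close> are multiples of \<open>u\<^sup>3 = y powr (3/2)\<close>. Markov's inequality with a small factor of
  proportionality gives the upper bound. The lower bound is the Paley-Zygmund inequality for
  \<open>exp (\<theta> (G - N))\<close> with a factor so large that the first moment dominates the threshold. This
  settles \<open>1 \<le> u \<le> r / L\<close> for a constant \<open>L\<close>; smaller \<open>u\<close> are covered by monotonicity in \<open>y\<close>, and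
  for larger \<open>u\<close> the cost \<open>exp (- 2 N)\<close> of a single boundary weight of size \<open>2 N\<close> is already of the
  required order.
\<close>

section \<open>The recursion for last-passage times\<close>

lemma up_right_paths_origin: "up_right_paths (0, 0) (0, 0) = {[(0, 0)]}"
proof (intro equalityI subsetI)
  fix \<pi> assume "\<pi> \<in> up_right_paths (0, 0) (0, 0)"
  then have p: "up_right_path \<pi>" "hd \<pi> = (0, 0)" "last \<pi> = (0, 0)"
    by (auto simp: up_right_paths_def)
  from up_right_path_mono[OF p(1)] p(2,3) have "length \<pi> = 1" by simp
  then obtain a where "\<pi> = [a]" by (auto simp: length_Suc_conv)
  with p show "\<pi> \<in> {[(0, 0)]}" by simp
qed (simp add: up_right_paths_def up_right_path_def)

definition predecessors :: "vertex \<Rightarrow> vertex set" where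
  "predecessors v = {u. v = u + (1, 0) \<or> v = u + (0, 1)}"

lemma up_right_paths_last_step:
  assumes "v \<noteq> (0, 0)"
  shows "up_right_paths (0, 0) v = (\<Union>u\<in>predecessors v. (\<lambda>\<pi>. \<pi> @ [v]) ` up_right_paths (0, 0) u)"
proof (intro equalityI subsetI)
  fix \<pi> assume "\<pi> \<in> up_right_paths (0, 0) v"
  then have p: "up_right_path \<pi>" "hd \<pi> = (0, 0)" "last \<pi> = v"
    by (auto simp: up_right_paths_def)
  obtain \<pi>' w where \<pi>: "\<pi> = \<pi>' @ [w]"
    using p(1) by (metis rev_exhaust up_right_path_def)
  with p assms have ne: "\<pi>' \<noteq> []" and w: "w = v" by auto
  have "\<pi>' \<in> up_right_paths (0, 0) (last \<pi>')" "last \<pi>' \<in> predecessors v"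
    using p ne w \<pi>
    by (auto simp: up_right_paths_def up_right_path_def successively_append_iff predecessors_def)
  with \<pi> w show "\<pi> \<in> (\<Union>u\<in>predecessors v. (\<lambda>\<pi>. \<pi> @ [v]) ` up_right_paths (0, 0) u)"
    by blast
next
  fix \<pi> assume "\<pi> \<in> (\<Union>u\<in>predecessors v. (\<lambda>\<pi>. \<pi> @ [v]) ` up_right_paths (0, 0) u)"
  then show "\<pi> \<in> up_right_paths (0, 0) v"
    by (auto simp: predecessors_def intro: up_right_paths_snoc)
qed

lemma predecessors_simps:
  "predecessors (Suc i, 0) = {(i, 0)}"
  "predecessors (0, Suc j) = {(0, j)}"
  "predecessors (Suc i, Suc j) = {(i, Suc j), (Suc i, j)}"
  by (auto simp: predecessors_def)

lemma Max_path_weight_snoc: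
  "Max (path_weight \<omega> ` (\<lambda>\<pi>. \<pi> @ [v]) ` up_right_paths (0, 0) u) = G_stat \<omega> u + \<omega> v"
proof -
  have "path_weight \<omega> ` (\<lambda>\<pi>. \<pi> @ [v]) ` up_right_paths (0, 0) u
      = (\<lambda>\<pi>. path_weight \<omega> \<pi> + \<omega> v) ` up_right_paths (0, 0) u"
    by (auto simp: path_weight_def image_image)
  then show ?thesis
    using Max_add_commute[OF finite_up_right_paths up_right_paths_nonempty]
    by (simp add: G_stat_def)
qed

lemma G_stat_origin [simp]: "G_stat \<omega> (0, 0) = \<omega> (0, 0)"
  by (simp add: G_stat_def up_right_paths_origin path_weight_def)

lemma G_stat_horizontal [simp]: "G_stat \<omega> (Suc i, 0) = G_stat \<omega> (i, 0) + \<omega> (Suc i, 0)"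
  using Max_path_weight_snoc[of \<omega> "(Suc i, 0)" "(i, 0)"]
  by (simp add: G_stat_def[of \<omega> "(Suc i, 0)"] up_right_paths_last_step predecessors_simps)

lemma G_stat_vertical [simp]: "G_stat \<omega> (0, Suc j) = G_stat \<omega> (0, j) + \<omega> (0, Suc j)"
  using Max_path_weight_snoc[of \<omega> "(0, Suc j)" "(0, j)"]
  by (simp add: G_stat_def[of \<omega> "(0, Suc j)"] up_right_paths_last_step predecessors_simps)

lemma G_stat_bulk [simp]:
  "G_stat \<omega> (Suc i, Suc j) = max (G_stat \<omega> (i, Suc j)) (G_stat \<omega> (Suc i, j)) + \<omega> (Suc i, Suc j)"
proof -
  have "G_stat \<omega> (Suc i, Suc j) =
      max (G_stat \<omega> (i, Suc j) + \<omega> (Suc i, Suc j)) (G_stat \<omega> (Suc i, j) + \<omega> (Suc i, Suc j))"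
    unfolding Max_path_weight_snoc[symmetric]
    by (subst Max_Un[symmetric])
       (simp_all add: finite_up_right_paths up_right_paths_nonempty image_Un
         G_stat_def[of \<omega> "(Suc i, Suc j)"] up_right_paths_last_step[of "(Suc i, Suc j)"]
         predecessors_simps)
  then show ?thesis by simp
qed

lemma lattice_induct [case_names origin horizontal vertical bulk]:
  assumes "P 0 0" "\<And>i. P i 0 \<Longrightarrow> P (Suc i) 0" "\<And>j. P 0 j \<Longrightarrow> P 0 (Suc j)"
    "\<And>i j. P i (Suc j) \<Longrightarrow> P (Suc i) j \<Longrightarrow> P (Suc i) (Suc j)"
  shows "P i (j :: nat)"
proof (induction i arbitrary: j)
  case 0
  show ?case by (induction j) (auto intro: assms)
next
  case (Suc i)
  then show ?case by (induction j) (auto intro: assms)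
qed

lemma G_stat_cong:
  assumes "\<And>v. v \<in> {..i} \<times> {..j} \<Longrightarrow> \<omega> v = \<omega>' v"
  shows "G_stat \<omega> (i, j) = G_stat \<omega>' (i, j)"
  using assms by (induction i j rule: lattice_induct) auto

lemma G_stat_mono:
  assumes "\<And>v. \<omega> v \<le> \<omega>' v"
  shows "G_stat \<omega> (i, j) \<le> G_stat \<omega>' (i, j)"
  by (induction i j rule: lattice_induct) (auto intro!: add_mono assms simp: max.coboundedI1 max.coboundedI2)

lemma borel_measurable_G_stat_PiM:
  assumes "i \<le> m" "j \<le> n"
  shows "(\<lambda>\<omega>. G_stat \<omega> (i, j)) \<in> borel_measurable (PiM ({..m} \<times> {..n}) (\<lambda>_. borel))"
  using assms by (induction i j rule: lattice_induct) auto

text \<open>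
  Multiplying an exponential variable by \<open>s\<close> divides its rate by \<open>s\<close>, so this map couples the
  models with different boundary rates.
\<close>
definition scale_axes :: "real \<Rightarrow> real \<Rightarrow> (vertex \<Rightarrow> real) \<Rightarrow> vertex \<Rightarrow> real" where
  "scale_axes s t \<omega> v = (if snd v = 0 then s * \<omega> v else if fst v = 0 then t * \<omega> v else \<omega> v)"

text \<open>
  A path that leaves the origin horizontally meets no further vertex of the vertical axis and so
  does not feel a rescaling of that axis; symmetrically for the other axis. In the recursion this
  says that the two scaled passage times agree with \<open>G_stat \<omega>\<close> on one axis each, and the
  domination by their maximum propagates through the bulk.
\<close>
lemma G_stat_le_max_scale_axes:
  assumes "\<omega> (0, 0) = 0"
  shows "G_stat \<omega> (i, j) \<le> max (G_stat (scale_axes 1 t \<omega>) (i, j)) (G_stat (scale_axes s 1 \<omega>) (i, j))"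
proof -
  have h: "G_stat (scale_axes 1 t \<omega>) (i, 0) = G_stat \<omega> (i, 0)" for i
    by (induction i) (auto simp: scale_axes_def)
  have v: "G_stat (scale_axes s 1 \<omega>) (0, j) = G_stat \<omega> (0, j)" for j
    using assms by (induction j) (auto simp: scale_axes_def)
  show ?thesis
  proof (induction i j rule: lattice_induct)
    case (bulk i j)
    moreover have "scale_axes s t \<omega> (Suc i, Suc j) = \<omega> (Suc i, Suc j)" for s t
      by (simp add: scale_axes_def)
    ultimately show ?case by (simp add: max_def split: if_splits)
  qed (auto simp only: h v max.cobounded1 max.cobounded2)
qed

lemma G_stat_scale_axes_le:
  assumes "s \<le> 1" "t \<le> 1" "\<And>v. 0 \<le> \<omega> v"
  shows "G_stat (scale_axes s t \<omega>) (i, j) \<le> G_stat \<omega> (i, j)"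
proof (rule G_stat_mono)
  fix v show "scale_axes s t \<omega> v \<le> \<omega> v"
    using mult_right_mono[of s 1 "\<omega> v"] mult_right_mono[of t 1 "\<omega> v"] assms
    by (simp add: scale_axes_def)
qed

section \<open>Corner flips transport the vertical increments\<close>

text \<open>
  At a lattice corner let \<open>a\<close> be the horizontal increment of \<open>G\<close> entering from below, \<open>b\<close> the
  vertical increment entering from the left and \<open>w\<close> the weight. The increments that leave the
  corner at the top and on the right are \<open>max (a - b) 0 + w\<close> and \<open>max (b - a) 0 + w\<close>. Storing
  \<open>min a b\<close> in place of the used weight makes the flip an involution of the positive octant, and
  each flip acts on a single fixed family of coordinates: \<open>(i, 0)\<close> carries the horizontal increment
  of column \<open>i\<close> and \<open>(0, j)\<close> the vertical increment of row \<open>j\<close>.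
\<close>
definition corner_flip :: "nat \<Rightarrow> nat \<Rightarrow> (vertex \<Rightarrow> real) \<Rightarrow> vertex \<Rightarrow> real" where
  "corner_flip i j \<eta> = (let a = \<eta> (i, 0); b = \<eta> (0, j); w = \<eta> (i, j) in
     \<eta>((i, 0) := max (a - b) 0 + w, (0, j) := max (b - a) 0 + w, (i, j) := min a b))"

fun sweep_column :: "nat \<Rightarrow> nat \<Rightarrow> (vertex \<Rightarrow> real) \<Rightarrow> vertex \<Rightarrow> real" where
  "sweep_column i 0 \<omega> = \<omega>"
| "sweep_column i (Suc j) \<omega> = corner_flip i (Suc j) (sweep_column i j \<omega>)"

fun sweep :: "nat \<Rightarrow> nat \<Rightarrow> (vertex \<Rightarrow> real) \<Rightarrow> vertex \<Rightarrow> real" where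
  "sweep n 0 \<omega> = \<omega>"
| "sweep n (Suc i) \<omega> = sweep_column (Suc i) n (sweep n i \<omega>)"

lemma sweep_column_other:
  "v \<noteq> (i, 0) \<Longrightarrow> fst v \<noteq> 0 \<or> snd v = 0 \<or> snd v > j \<Longrightarrow> fst v \<noteq> i \<or> snd v > j \<Longrightarrow>
    sweep_column i j \<omega> v = \<omega> v"
  by (induction j) (auto simp: corner_flip_def Let_def)

lemma sweep_unchanged: "i < i' \<Longrightarrow> sweep n i \<omega> (i', j) = \<omega> (i', j)"
proof (induction i)
  case (Suc i)
  then show ?case by (auto simp: sweep_column_other)
qed simp

lemma sweep_origin: "sweep n i \<omega> (0, 0) = \<omega> (0, 0)"
  by (induction i) (auto simp: sweep_column_other)

text \<open>
  If the vertical coordinates hold the increments of \<open>G\<close> along column \<open>i\<close>, then after \<open>j\<close> flips the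
  lowest \<open>j\<close> of them have moved on to column \<open>i + 1\<close>, and the coordinate \<open>(i + 1, 0)\<close> has climbed to
  the horizontal increment in row \<open>j\<close>.
\<close>
lemma sweep_column_increments:
  assumes "\<And>l. l < n \<Longrightarrow> \<eta> (0, Suc l) = G_stat \<omega> (i, Suc l) - G_stat \<omega> (i, l)"
    and "\<And>l. \<eta> (Suc i, l) = \<omega> (Suc i, l)" and "j \<le> n"
  shows "sweep_column (Suc i) j \<eta> (Suc i, 0) = G_stat \<omega> (Suc i, j) - G_stat \<omega> (i, j) \<and>
    (\<forall>l<j. sweep_column (Suc i) j \<eta> (0, Suc l) = G_stat \<omega> (Suc i, Suc l) - G_stat \<omega> (Suc i, l))"
  using assms(3)
proof (induction j)
  case 0
  then show ?case using assms(2) by simp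
next
  case (Suc j)
  let ?S = "sweep_column (Suc i) j \<eta>"
  have "?S (0, Suc j) = G_stat \<omega> (i, Suc j) - G_stat \<omega> (i, j)"
    "?S (Suc i, Suc j) = \<omega> (Suc i, Suc j)"
    using assms Suc.prems by (auto simp: sweep_column_other)
  moreover have "?S (Suc i, 0) = G_stat \<omega> (Suc i, j) - G_stat \<omega> (i, j)"
    "\<And>l. l < j \<Longrightarrow> ?S (0, Suc l) = G_stat \<omega> (Suc i, Suc l) - G_stat \<omega> (Suc i, l)"
    using Suc by auto
  ultimately show ?case
    by (auto simp: corner_flip_def Let_def less_Suc_eq max_def)
qed

lemma sweep_increments:
  "j < n \<Longrightarrow> sweep n i \<omega> (0, Suc j) = G_stat \<omega> (i, Suc j) - G_stat \<omega> (i, j)"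
proof (induction i arbitrary: j)
  case (Suc i)
  then show ?case
    using sweep_column_increments[of n "sweep n i \<omega>" \<omega> i n] by (simp add: sweep_unchanged)
qed simp

text \<open>
  The path along the horizontal axis and then up to \<open>(m, n)\<close> telescopes: its vertical part is read
  off from the swept configuration, in which the origin keeps its weight.
\<close>
lemma G_stat_eq_sweep:
  "G_stat \<omega> (m, n) = (\<Sum>i\<in>{1..m}. \<omega> (i, 0)) + (\<Sum>j\<in>{0..n}. sweep n m \<omega> (0, j))"
proof -
  have "(\<Sum>j\<in>{1..n}. sweep n m \<omega> (0, j)) = (\<Sum>j<n. G_stat \<omega> (m, Suc j) - G_stat \<omega> (m, j))"
    by (simp add: sweep_increments sum.atLeast1_atMost_eq del: G_stat_vertical G_stat_bulk)
  also have "\<dots> = G_stat \<omega> (m, n) - G_stat \<omega> (m, 0)"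
    by (rule sum_lessThan_telescope)
  also have "G_stat \<omega> (m, 0) = \<omega> (0, 0) + (\<Sum>i\<in>{1..m}. \<omega> (i, 0))"
    by (induction m) auto
  finally show ?thesis
    by (simp add: sum.atLeast_Suc_atMost sweep_origin)
qed

section \<open>Flips preserve the stationary law\<close>

lemma nn_integral_exp_law:
  assumes "f \<in> borel_measurable borel"
  shows "(\<integral>\<^sup>+x. f x \<partial>exp_law l) = (\<integral>\<^sup>+x. ennreal (exponential_density l x) * f x \<partial>lborel)"
  using assms by (intro nn_integral_density) auto

lemma nn_integral_lborel_shift:
  fixes f :: "real \<Rightarrow> ennreal"
  assumes "f \<in> borel_measurable borel"
  shows "(\<integral>\<^sup>+x. f x \<partial>lborel) = (\<integral>\<^sup>+x. f (t + x) \<partial>lborel)"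
  using nn_integral_real_affine[OF assms, of 1 t] by simp

text \<open>
  Two independent exponentials of rates \<open>z\<close> and \<open>1 - z\<close> are \<open>max d 0 + k\<close> and \<open>max (- d) 0 + k\<close>,
  where their minimum \<open>k\<close> has rate \<open>z + (1 - z) = 1\<close> and is independent of their difference \<open>d\<close>.
  This is where the rates have to add up to the bulk rate.
\<close>
lemma nn_integral_exp_pair:
  assumes z: "0 < z" "z < 1"
    and [measurable]: "case_prod H \<in> borel_measurable (borel \<Otimes>\<^sub>M borel)"
  shows "(\<integral>\<^sup>+a. \<integral>\<^sup>+b. H a b \<partial>exp_law (1 - z) \<partial>exp_law z) =
    (\<integral>\<^sup>+d. ennreal (z * (1 - z) * exp (- z * max d 0 - (1 - z) * max (- d) 0)) *
       (\<integral>\<^sup>+k. H (max d 0 + k) (max (- d) 0 + k) \<partial>exp_law 1) \<partial>lborel)"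
proof -
  define f where "f a b = ennreal (exponential_density z a) * ennreal (exponential_density (1 - z) b) * H a b"
    for a b
  have f [measurable]: "case_prod f \<in> borel_measurable (borel \<Otimes>\<^sub>M borel)"
    unfolding f_def by measurable
  have dens: "f (max (- d) 0 + k + d) (max (- d) 0 + k) =
      ennreal (z * (1 - z) * exp (- z * max d 0 - (1 - z) * max (- d) 0)) *
      (ennreal (exponential_density 1 k) * H (max d 0 + k) (max (- d) 0 + k))" for d k
  proof -
    have shift: "max (- d) 0 + k + d = max d 0 + k" by simp
    have "exponential_density z (max d 0 + k) * exponential_density (1 - z) (max (- d) 0 + k)
        = z * (1 - z) * exp (- z * max d 0 - (1 - z) * max (- d) 0) * exponential_density 1 k"
      by (auto simp: exponential_density_def max_def algebra_simps simp flip: exp_add)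
    then show ?thesis
      using z by (simp add: f_def shift mult.assoc[symmetric] exponential_density_nonneg flip: ennreal_mult')
  qed
  have "(\<integral>\<^sup>+a. \<integral>\<^sup>+b. H a b \<partial>exp_law (1 - z) \<partial>exp_law z) = (\<integral>\<^sup>+a. \<integral>\<^sup>+b. f a b \<partial>lborel \<partial>lborel)"
    unfolding f_def by (simp add: nn_integral_exp_law nn_integral_cmult[symmetric] mult.assoc)
  also have "\<dots> = (\<integral>\<^sup>+b. \<integral>\<^sup>+a. f a b \<partial>lborel \<partial>lborel)"
    by (rule lborel_pair.Fubini') measurable
  \<comment> \<open>Pass from \<open>(a, b)\<close> to \<open>(d, b)\<close> with \<open>d = a - b\<close>, and below from \<open>b\<close> to \<open>k = b - max (- d) 0\<close>.\<close>
  also have "\<dots> = (\<integral>\<^sup>+b. \<integral>\<^sup>+d. f (b + d) b \<partial>lborel \<partial>lborel)"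
    by (rule nn_integral_cong, rule nn_integral_lborel_shift) measurable
  also have "\<dots> = (\<integral>\<^sup>+d. \<integral>\<^sup>+b. f (b + d) b \<partial>lborel \<partial>lborel)"
    by (rule lborel_pair.Fubini') measurable
  also have "\<dots> = (\<integral>\<^sup>+d. \<integral>\<^sup>+k. f (max (- d) 0 + k + d) (max (- d) 0 + k) \<partial>lborel \<partial>lborel)"
    by (rule nn_integral_cong, rule nn_integral_lborel_shift) measurable
  also have "\<dots> = (\<integral>\<^sup>+d. ennreal (z * (1 - z) * exp (- z * max d 0 - (1 - z) * max (- d) 0)) *
       (\<integral>\<^sup>+k. H (max d 0 + k) (max (- d) 0 + k) \<partial>exp_law 1) \<partial>lborel)"
    unfolding dens by (simp add: nn_integral_exp_law nn_integral_cmult)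
  finally show ?thesis .
qed

lemma borel_measurable_uncurry3:
  assumes F: "(\<lambda>(a, b, w). F a b w) \<in> borel_measurable (borel \<Otimes>\<^sub>M borel \<Otimes>\<^sub>M borel)"
    and [measurable]: "p \<in> measurable N borel" "q \<in> measurable N borel" "r \<in> measurable N borel"
  shows "(\<lambda>x. F (p x) (q x) (r x)) \<in> borel_measurable N"
  using measurable_compose[OF _ F, of "\<lambda>x. (p x, q x, r x)" N] by simp

text \<open>
  In the coordinates \<open>d\<close>, \<open>k\<close> of \<open>nn_integral_exp_pair\<close> a corner flip fixes \<open>d\<close> and exchanges the
  minimum \<open>k\<close> with the weight \<open>w\<close>. Both have rate \<open>1\<close>, so the law is preserved.
\<close>
lemma nn_integral_corner:
  assumes z: "0 < z" "z < 1"
    and F [measurable]: "(\<lambda>(a, b, w). F a b w) \<in> borel_measurable (borel \<Otimes>\<^sub>M borel \<Otimes>\<^sub>M borel)"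
  shows "(\<integral>\<^sup>+a. \<integral>\<^sup>+b. \<integral>\<^sup>+w. F (max (a - b) 0 + w) (max (b - a) 0 + w) (min a b)
             \<partial>exp_law 1 \<partial>exp_law (1 - z) \<partial>exp_law z)
       = (\<integral>\<^sup>+a. \<integral>\<^sup>+b. \<integral>\<^sup>+w. F a b w \<partial>exp_law 1 \<partial>exp_law (1 - z) \<partial>exp_law z)"
proof -
  interpret E: prob_space "exp_law 1" by (rule prob_space_exponential_density) simp
  interpret EE: pair_sigma_finite "exp_law 1" "exp_law 1" ..
  note Fm [measurable (raw)] = borel_measurable_uncurry3[OF F]
  have swap: "(\<integral>\<^sup>+k. \<integral>\<^sup>+w. F (max d 0 + w) (max (- d) 0 + w) k \<partial>exp_law 1 \<partial>exp_law 1)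
      = (\<integral>\<^sup>+k. \<integral>\<^sup>+w. F (max d 0 + k) (max (- d) 0 + k) w \<partial>exp_law 1 \<partial>exp_law 1)" for d
    by (rule EE.Fubini') (simp add: split_beta')
  have diff: "max (max d 0 + k - (max (- d) 0 + k)) 0 = max d 0"
    "max (max (- d) 0 + k - (max d 0 + k)) 0 = max (- d) 0"
    "min (max d 0 + k) (max (- d) 0 + k) = k" for d k :: real
    by auto
  show ?thesis
    by (subst (1 2) nn_integral_exp_pair[OF z]) (simp_all only: diff swap, measurable)
qed

definition axes_law :: "real \<Rightarrow> real \<Rightarrow> vertex \<Rightarrow> real measure" where
  "axes_law a b v =
     (if v = (0, 0) then return borel 0
      else if snd v = 0 then exp_law a
      else if fst v = 0 then exp_law b
      else exp_law 1)"

lemma sets_axes_law [simp, measurable_cong]: "sets (axes_law a b v) = sets borel"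
  by (simp add: axes_law_def)

lemma space_axes_law [simp]: "space (axes_law a b v) = UNIV"
  by (simp add: axes_law_def)

lemma product_prob_space_axes_law:
  assumes "0 < a" "0 < b"
  shows "product_prob_space (axes_law a b)"
proof -
  interpret prob_space "axes_law a b v" for v
    using assms by (auto simp: axes_law_def intro!: prob_space_return prob_space_exponential_density)
  show ?thesis by unfold_locales
qed

lemma sets_PiM_axes_law [measurable_cong]:
  "sets (PiM K (axes_law a b)) = sets (PiM K (\<lambda>_. borel))"
  by (rule sets_PiM_cong) auto

lemma measurable_corner_flip:
  assumes "(i, 0) \<in> K" "(0, j) \<in> K" "(i, j) \<in> K"
  shows "corner_flip i j \<in> measurable (PiM K (\<lambda>_. borel)) (PiM K (\<lambda>_. borel))"
  unfolding corner_flip_def Let_def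
  by (intro measurable_fun_upd[where J=K] measurable_ident_sets[OF refl, unfolded id_def]
       borel_measurable_add borel_measurable_max borel_measurable_min borel_measurable_diff
       measurable_component_singleton) (use assms in auto)

text \<open>
  Integrating out the other coordinates last reduces the statement to the three coordinates of the
  corner.
\<close>
lemma nn_integral_corner_flip:
  assumes z: "0 < z" "z < 1" and K: "finite K" "(i, 0) \<in> K" "(0, j) \<in> K" "(i, j) \<in> K"
    and ij: "0 < i" "0 < j" and f [measurable]: "f \<in> borel_measurable (PiM K (\<lambda>_. borel))"
  shows "(\<integral>\<^sup>+\<eta>. f (corner_flip i j \<eta>) \<partial>PiM K (axes_law z (1 - z))) =
    (\<integral>\<^sup>+\<eta>. f \<eta> \<partial>PiM K (axes_law z (1 - z)))"
proof -
  interpret product_prob_space "axes_law z (1 - z)"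
    by (rule product_prob_space_axes_law) (use z in auto)
  define L where "L = K - {(i, 0), (0, j), (i, j)}"
  have KL: "K = insert (i, 0) (insert (0, j) (insert (i, j) L))"
    using K by (auto simp: L_def)
  have L [simp]: "finite L" "(i, 0) \<notin> insert (0, j) (insert (i, j) L)"
     "(0, j) \<notin> insert (i, j) L" "(i, j) \<notin> L"
    using K ij by (auto simp: L_def)
  interpret L: finite_product_sigma_finite "axes_law z (1 - z)" L by standard simp
  have [measurable]: "(\<lambda>x. (snd x)((i, j) := snd (snd (fst x)), (0, j) := fst (snd (fst x)), (i, 0) := fst (fst x)))
      \<in> measurable ((borel \<Otimes>\<^sub>M borel \<Otimes>\<^sub>M borel) \<Otimes>\<^sub>M PiM L (\<lambda>_. borel)) (PiM K (\<lambda>_. borel :: real measure))"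
    unfolding KL by measurable
  have law: "axes_law z (1 - z) (i, 0) = exp_law z" "axes_law z (1 - z) (0, j) = exp_law (1 - z)"
    "axes_law z (1 - z) (i, j) = exp_law 1"
    using ij by (auto simp: axes_law_def)
  have peel: "(\<integral>\<^sup>+\<eta>. g \<eta> \<partial>PiM K (axes_law z (1 - z))) =
      (\<integral>\<^sup>+a. \<integral>\<^sup>+b. \<integral>\<^sup>+w. \<integral>\<^sup>+\<eta>. g (\<eta>((i, j) := w, (0, j) := b, (i, 0) := a))
         \<partial>PiM L (axes_law z (1 - z)) \<partial>exp_law 1 \<partial>exp_law (1 - z) \<partial>exp_law z)"
    if g: "g \<in> borel_measurable (PiM K (\<lambda>_. borel))" for g :: "_ \<Rightarrow> ennreal"
  proof -
    have g1 [measurable]: "g \<in> borel_measurable (PiM (insert (i, 0) (insert (0, j) (insert (i, j) L))) (axes_law z (1 - z)))"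
      using g unfolding KL by (simp cong: measurable_cong_sets add: sets_PiM_axes_law)
    have g2: "(\<lambda>\<eta>. g (\<eta>((i, 0) := a))) \<in> borel_measurable (PiM (insert (0, j) (insert (i, j) L)) (axes_law z (1 - z)))" for a
      by measurable
    have g3: "(\<lambda>\<eta>. g (\<eta>((0, j) := b, (i, 0) := a))) \<in> borel_measurable (PiM (insert (i, j) L) (axes_law z (1 - z)))" for a b
      by measurable
    show ?thesis
      unfolding KL
      using L(2-) by (simp only: product_nn_integral_insert_rev[OF _ _ g1] product_nn_integral_insert_rev[OF _ _ g2]
          product_nn_integral_insert_rev[OF _ _ g3] finite_insert L(1) law simp_thms not_False_eq_True)
  qed
  define F where "F a b w = (\<integral>\<^sup>+\<eta>. f (\<eta>((i, j) := w, (0, j) := b, (i, 0) := a))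
      \<partial>PiM L (axes_law z (1 - z)))" for a b w
  have "(\<lambda>(a, b, w). F a b w) \<in> borel_measurable (borel \<Otimes>\<^sub>M borel \<Otimes>\<^sub>M borel)"
    unfolding F_def by measurable
  note corner = nn_integral_corner[OF z this]
  have flip: "corner_flip i j (\<eta>((i, j) := w, (0, j) := b, (i, 0) := a)) =
      \<eta>((i, j) := min a b, (0, j) := max (b - a) 0 + w, (i, 0) := max (a - b) 0 + w)" for \<eta> a b w
    using ij by (auto simp: corner_flip_def fun_eq_iff)
  have "(\<lambda>\<eta>. f (corner_flip i j \<eta>)) \<in> borel_measurable (PiM K (\<lambda>_. borel))"
    by (rule measurable_compose[OF measurable_corner_flip f]) (use K in auto)
  from peel[OF this] corner peel[OF f] show ?thesis
    by (simp add: flip F_def)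
qed

section \<open>The exact exponential moment\<close>

lemma density_PiM:
  assumes K: "finite K" and M: "product_sigma_finite M" and N: "product_sigma_finite N"
    and h: "\<And>v. v \<in> K \<Longrightarrow> h v \<in> borel_measurable (M v)"
    and NM: "\<And>v. v \<in> K \<Longrightarrow> N v = density (M v) (h v)"
  shows "density (PiM K M) (\<lambda>\<eta>. \<Prod>v\<in>K. h v (\<eta> v)) = PiM K N"
proof -
  interpret M: product_sigma_finite M by fact
  interpret N: product_sigma_finite N by fact
  have [measurable]: "(\<lambda>\<eta>. \<Prod>v\<in>K. h v (\<eta> v)) \<in> borel_measurable (PiM K M)"
  proof (intro borel_measurable_prod_ennreal)
    fix v assume v: "v \<in> K"
    show "(\<lambda>\<eta>. h v (\<eta> v)) \<in> borel_measurable (PiM K M)"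
      using v h[OF v] by (intro measurable_compose[of "\<lambda>\<eta>. \<eta> v" "PiM K M" "M v" "h v"]) simp_all
  qed
  show ?thesis
  proof (rule N.PiM_eqI)
    show "sets (density (PiM K M) (\<lambda>\<eta>. \<Prod>v\<in>K. h v (\<eta> v))) = sets (PiM K N)"
      unfolding sets_density by (rule sets_PiM_cong) (simp_all add: NM)
    fix A assume "\<And>v. v \<in> K \<Longrightarrow> A v \<in> sets (N v)"
    then have A: "A v \<in> sets (M v)" if "v \<in> K" for v using that by (simp add: NM)
    have "emeasure (density (PiM K M) (\<lambda>\<eta>. \<Prod>v\<in>K. h v (\<eta> v))) (Pi\<^sub>E K A) =
        (\<integral>\<^sup>+\<eta>. (\<Prod>v\<in>K. h v (\<eta> v)) * indicator (Pi\<^sub>E K A) \<eta> \<partial>PiM K M)"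
      using A K by (intro emeasure_density sets_PiM_I_finite) auto
    also have "\<dots> = (\<integral>\<^sup>+\<eta>. (\<Prod>v\<in>K. h v (\<eta> v) * indicator (A v) (\<eta> v)) \<partial>PiM K M)"
    proof (rule nn_integral_cong)
      fix \<eta> assume "\<eta> \<in> space (PiM K M)"
      then have "indicator (Pi\<^sub>E K A) \<eta> = (\<Prod>v\<in>K. indicator (A v) (\<eta> v) :: ennreal)"
        using K by (auto simp: indicator_def space_PiM PiE_iff intro!: prod_zero[symmetric] prod.neutral[symmetric])
      then show "(\<Prod>v\<in>K. h v (\<eta> v)) * indicator (Pi\<^sub>E K A) \<eta> = (\<Prod>v\<in>K. h v (\<eta> v) * indicator (A v) (\<eta> v))"
        by (simp add: prod.distrib)
    qed
    also have "\<dots> = (\<Prod>v\<in>K. \<integral>\<^sup>+x. h v x * indicator (A v) x \<partial>M v)"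
      using K h A by (intro M.product_nn_integral_prod) auto
    also have "\<dots> = (\<Prod>v\<in>K. emeasure (N v) (A v))"
      using h A by (intro prod.cong) (auto simp: NM emeasure_density)
    finally show "emeasure (density (PiM K M) (\<lambda>\<eta>. \<Prod>v\<in>K. h v (\<eta> v))) (Pi\<^sub>E K A) =
        (\<Prod>v\<in>K. emeasure (N v) (A v))" .
  qed fact
qed

text \<open>Exponential tilting stays within the exponential family and shifts the rate.\<close>
lemma exp_law_tilt:
  assumes "0 < l" "\<theta> < l"
  shows "exp_law (l - \<theta>) = density (exp_law l) (\<lambda>x. ennreal ((l - \<theta>) / l * exp (\<theta> * x)))"
proof -
  have *: "exp (- x * l) * exp (\<theta> * x) = exp (- x * (l - \<theta>))" for x
    by (simp add: algebra_simps flip: exp_add)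
  have "exponential_density (l - \<theta>) x = exponential_density l x * ((l - \<theta>) / l * exp (\<theta> * x))" for x
    using assms *[of x] by (auto simp: exponential_density_def)
  then have "ennreal (exponential_density (l - \<theta>) x) =
      ennreal (exponential_density l x) * ennreal ((l - \<theta>) / l * exp (\<theta> * x))" for x
    using ennreal_mult'[of "exponential_density l x" "(l - \<theta>) / l * exp (\<theta> * x)" for x] assms(1)
    by (simp only: exponential_density_nonneg)
  then show ?thesis
    by (simp add: density_density_eq)
qed

lemma nn_integral_exp_law_exp:
  assumes "0 < l" "\<theta> < l"
  shows "(\<integral>\<^sup>+x. ennreal (exp (\<theta> * x)) \<partial>exp_law l) = ennreal (l / (l - \<theta>))"
proof -
  interpret prob_space "exp_law (l - \<theta>)"
    using assms by (intro prob_space_exponential_density) simp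
  have "(\<integral>\<^sup>+x. ennreal (exp (\<theta> * x)) \<partial>exp_law l) =
      (\<integral>\<^sup>+x. ennreal (l / (l - \<theta>)) * ennreal ((l - \<theta>) / l * exp (\<theta> * x)) \<partial>exp_law l)"
    using assms by (simp add: ennreal_mult[symmetric])
  also have "\<dots> = ennreal (l / (l - \<theta>)) * emeasure (exp_law (l - \<theta>)) UNIV"
    unfolding exp_law_tilt[OF assms] by (simp add: nn_integral_cmult emeasure_density)
  also have "emeasure (exp_law (l - \<theta>)) UNIV = 1"
    using emeasure_space_1 by simp
  finally show ?thesis by simp
qed

lemma distr_exp_law_scale:
  assumes "0 < s"
  shows "distr (exp_law l) borel (\<lambda>x. s * x) = exp_law (l / s)"
proof (rule measure_eqI)
  fix A assume "A \<in> sets (distr (exp_law l) borel (\<lambda>x. s * x))"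
  then have A [measurable]: "A \<in> sets borel" by simp
  have dens: "ennreal s * ennreal (exponential_density (l / s) (s * x)) = ennreal (exponential_density l x)" for x
    using assms by (auto simp: exponential_density_def zero_less_mult_iff mult_less_0_iff field_simps simp flip: ennreal_mult')
  have "emeasure (distr (exp_law l) borel (\<lambda>x. s * x)) A = (\<integral>\<^sup>+x. indicator A (s * x) \<partial>exp_law l)"
    by (subst nn_integral_distr[symmetric, of "\<lambda>x. s * x" _ borel "indicator A"]) auto
  also have "\<dots> = (\<integral>\<^sup>+x. ennreal s * (ennreal (exponential_density (l / s) (s * x)) * indicator A (s * x)) \<partial>lborel)"
    by (simp add: nn_integral_density dens mult.assoc[symmetric])
  also have "\<dots> = (\<integral>\<^sup>+x. ennreal (exponential_density (l / s) x) * indicator A x \<partial>lborel)"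
    using assms by (subst (2) nn_integral_real_affine[of _ s 0]) (auto simp: nn_integral_cmult)
  also have "\<dots> = emeasure (exp_law (l / s)) A"
    by (simp add: emeasure_density)
  finally show "emeasure (distr (exp_law l) borel (\<lambda>x. s * x)) A = emeasure (exp_law (l / s)) A" .
qed simp

text \<open>
  By independence the law of any family of rescaled weights is a product. For the finitely many
  weights that \<open>G\<close> at a given vertex depends on, this makes coordinatewise integration available.
\<close>
lemma distr_scale_axes:
  assumes \<rho>: "0 < \<rho>" "\<rho> < 1" and st: "0 < s" "0 < t" and K: "K \<noteq> {}"
  shows "distr (stat_measure \<rho>) (PiM K (\<lambda>_. borel)) (\<lambda>\<omega>. \<lambda>v\<in>K. scale_axes s t \<omega> v) =
    PiM K (axes_law ((1 - \<rho>) / s) (\<rho> / t))"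
proof -
  interpret prob_space "stat_measure \<rho>" by (rule prob_space_stat_measure) fact+
  define T where "T v x = (if snd v = 0 then s * x else if fst v = 0 then t * x else x)" for v :: vertex and x
  have T [measurable]: "T v \<in> borel_measurable borel" for v
    unfolding T_def by measurable
  have scale: "scale_axes s t \<omega> v = T v (\<omega> v)" for \<omega> v
    by (simp add: scale_axes_def T_def)
  have "indep_vars (\<lambda>_. borel) (\<lambda>v \<omega>. T v (\<omega> v)) K"
    by (rule indep_vars_subset[OF indep_vars_compose2[OF indep_vars_weight[OF \<rho>]]]) auto
  then have "distr (stat_measure \<rho>) (PiM K (\<lambda>_. borel)) (\<lambda>\<omega>. \<lambda>v\<in>K. scale_axes s t \<omega> v) =
      PiM K (\<lambda>v. distr (stat_measure \<rho>) borel (\<lambda>\<omega>. T v (\<omega> v)))"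
    using K by (subst (asm) indep_vars_iff_distr_eq_PiM') (auto simp: scale)
  also have "\<dots> = PiM K (axes_law ((1 - \<rho>) / s) (\<rho> / t))"
  proof (rule PiM_cong)
    fix v
    have "distr (stat_measure \<rho>) borel (\<lambda>\<omega>. T v (\<omega> v)) = distr (weight_law \<rho> v) borel (T v)"
      unfolding distr_weight[OF \<rho>, symmetric] by (subst distr_distr) (auto simp: comp_def)
    also have "\<dots> = axes_law ((1 - \<rho>) / s) (\<rho> / t) v"
    proof -
      have "distr (exp_law 1) borel (\<lambda>x. x) = exp_law 1" by (rule distr_id2) simp
      then show ?thesis
        using st distr_exp_law_scale[of s] distr_exp_law_scale[of t]
        by (auto simp: weight_law_def axes_law_def T_def[abs_def] distr_return)
    qed
    finally show "distr (stat_measure \<rho>) borel (\<lambda>\<omega>. T v (\<omega> v)) = axes_law ((1 - \<rho>) / s) (\<rho> / t) v" .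
  qed simp
  finally show ?thesis .
qed

lemma measurable_sweep_column:
  assumes "0 < i" "i \<le> m" "j \<le> n"
  shows "sweep_column i j \<in> measurable (PiM ({..m} \<times> {..n}) (\<lambda>_. borel)) (PiM ({..m} \<times> {..n}) (\<lambda>_. borel))"
  using assms(3)
proof (induction j)
  case (Suc j)
  have "corner_flip i (Suc j) \<in> measurable (PiM ({..m} \<times> {..n}) (\<lambda>_. borel)) (PiM ({..m} \<times> {..n}) (\<lambda>_. borel))"
    using assms Suc by (intro measurable_corner_flip) auto
  from measurable_compose[OF Suc.IH this] Suc.prems show ?case by simp
next
  case 0
  have "sweep_column i 0 = (\<lambda>\<eta>. \<eta>)" by auto
  then show ?case by simp
qed

lemma nn_integral_sweep_column:
  assumes z: "0 < z" "z < 1" and "0 < i" "i \<le> m" "j \<le> n"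
    and "f \<in> borel_measurable (PiM ({..m} \<times> {..n}) (\<lambda>_. borel))"
  shows "(\<integral>\<^sup>+\<eta>. f (sweep_column i j \<eta>) \<partial>PiM ({..m} \<times> {..n}) (axes_law z (1 - z))) =
    (\<integral>\<^sup>+\<eta>. f \<eta> \<partial>PiM ({..m} \<times> {..n}) (axes_law z (1 - z)))"
  using assms(5,6)
proof (induction j arbitrary: f)
  case (Suc j)
  have "(\<lambda>\<eta>. f (corner_flip i (Suc j) \<eta>)) \<in> borel_measurable (PiM ({..m} \<times> {..n}) (\<lambda>_. borel))"
    by (rule measurable_compose[OF measurable_corner_flip Suc.prems(2)]) (use assms Suc.prems in auto)
  then have "(\<integral>\<^sup>+\<eta>. f (sweep_column i (Suc j) \<eta>) \<partial>PiM ({..m} \<times> {..n}) (axes_law z (1 - z))) =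
     (\<integral>\<^sup>+\<eta>. f (corner_flip i (Suc j) \<eta>) \<partial>PiM ({..m} \<times> {..n}) (axes_law z (1 - z)))"
    using Suc by simp
  also have "\<dots> = (\<integral>\<^sup>+\<eta>. f \<eta> \<partial>PiM ({..m} \<times> {..n}) (axes_law z (1 - z)))"
    by (rule nn_integral_corner_flip) (use assms Suc.prems in auto)
  finally show ?case .
qed simp

lemma nn_integral_sweep:
  assumes z: "0 < z" "z < 1" and "i \<le> m"
    and "f \<in> borel_measurable (PiM ({..m} \<times> {..n}) (\<lambda>_. borel))"
  shows "(\<integral>\<^sup>+\<eta>. f (sweep n i \<eta>) \<partial>PiM ({..m} \<times> {..n}) (axes_law z (1 - z))) =
    (\<integral>\<^sup>+\<eta>. f \<eta> \<partial>PiM ({..m} \<times> {..n}) (axes_law z (1 - z)))"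
  using assms(3,4)
proof (induction i arbitrary: f)
  case (Suc i)
  have "(\<lambda>\<eta>. f (sweep_column (Suc i) n \<eta>)) \<in> borel_measurable (PiM ({..m} \<times> {..n}) (\<lambda>_. borel))"
    by (rule measurable_compose[OF measurable_sweep_column Suc.prems(2)]) (use Suc.prems in auto)
  with Suc have "(\<integral>\<^sup>+\<eta>. f (sweep n (Suc i) \<eta>) \<partial>PiM ({..m} \<times> {..n}) (axes_law z (1 - z))) =
     (\<integral>\<^sup>+\<eta>. f (sweep_column (Suc i) n \<eta>) \<partial>PiM ({..m} \<times> {..n}) (axes_law z (1 - z)))"
    by simp
  also have "\<dots> = (\<integral>\<^sup>+\<eta>. f \<eta> \<partial>PiM ({..m} \<times> {..n}) (axes_law z (1 - z)))"
    by (rule nn_integral_sweep_column) (use Suc.prems z in auto)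
  finally show ?case .
qed simp

lemma measurable_sweep:
  assumes "i \<le> m"
  shows "sweep n i \<in> measurable (PiM ({..m} \<times> {..n}) (\<lambda>_. borel)) (PiM ({..m} \<times> {..n}) (\<lambda>_. borel))"
  using assms
proof (induction i)
  case (Suc i)
  have "sweep_column (Suc i) n \<in> measurable (PiM ({..m} \<times> {..n}) (\<lambda>_. borel)) (PiM ({..m} \<times> {..n}) (\<lambda>_. borel))"
    using Suc.prems by (intro measurable_sweep_column) auto
  from measurable_compose[OF Suc.IH this] Suc.prems show ?case by simp
next
  case 0
  have "sweep n 0 = (\<lambda>\<eta>. \<eta>)" by auto
  then show ?case by simp
qed

text \<open>
  Put \<open>\<theta> = a + b - 1\<close> and split \<open>G(m, n)\<close> into the weights on the horizontal axis and the increments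
  along the line through \<open>m\<close>. The first part of \<open>exp (\<theta> G)\<close> is, up to the constant
  \<open>(a / (1 - b)) ^ m\<close>, the density of the stationary model with rates \<open>1 - b\<close> and \<open>b\<close> relative to the
  given one. Under the stationary model the sweep preserves expectations, which leaves \<open>n\<close>
  independent increments of rate \<open>b\<close>, each contributing \<open>b / (b - \<theta>) = b / (1 - a)\<close>.
\<close>
theorem nn_integral_exp_G_stat:
  assumes a: "0 < a" "a < 1" and b: "0 < b" "b < 1"
  shows "(\<integral>\<^sup>+\<eta>. ennreal (exp ((a + b - 1) * G_stat \<eta> (m, n))) \<partial>PiM ({..m} \<times> {..n}) (axes_law a b)) =
    ennreal ((a / (1 - b)) ^ m * (b / (1 - a)) ^ n)"
proof -
  define K where "K = {..m} \<times> {..n}"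
  have K: "finite K" by (simp add: K_def)
  define \<theta> where "\<theta> = a + b - 1"
  have \<theta>: "a - \<theta> = 1 - b" "b - \<theta> = 1 - a" by (simp_all add: \<theta>_def)
  interpret product_prob_space "axes_law (1 - b) b"
    by (rule product_prob_space_axes_law) (use b in auto)
  interpret AB: product_prob_space "axes_law a b"
    by (rule product_prob_space_axes_law) (use a b in auto)
  define f :: "(vertex \<Rightarrow> real) \<Rightarrow> ennreal" where "f \<eta> = (\<Prod>j\<in>{0..n}. ennreal (exp (\<theta> * \<eta> (0, j))))" for \<eta>
  \<comment> \<open>The density of rate \<open>1 - b\<close> relative to rate \<open>a\<close> on the horizontal axis without the origin.\<close>
  define h :: "vertex \<Rightarrow> real \<Rightarrow> ennreal" where
    "h v x = (if 0 < fst v \<and> snd v = 0 then ennreal ((1 - b) / a * exp (\<theta> * x)) else 1)" for v x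
  have comp: "(\<lambda>\<eta>. \<eta> v) \<in> borel_measurable (PiM K (\<lambda>_. borel :: real measure))" if "v \<in> K" for v
    using that by (rule measurable_component_singleton)
  have f [measurable]: "f \<in> borel_measurable (PiM K (\<lambda>_. borel))"
    unfolding f_def by (intro borel_measurable_prod_ennreal measurable_compose[OF comp]) (auto simp: K_def)
  have tilt: "density (PiM K (axes_law a b)) (\<lambda>\<eta>. \<Prod>v\<in>K. h v (\<eta> v)) = PiM K (axes_law (1 - b) b)"
  proof (rule density_PiM[OF K])
    fix v
    show "axes_law (1 - b) b v = density (axes_law a b v) (h v)"
    proof (cases "0 < fst v \<and> snd v = 0")
      case True
      then show ?thesis
        using exp_law_tilt[of a \<theta>] a b \<theta> by (auto simp: axes_law_def h_def[abs_def])
    next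
      case False
      then have "h v = (\<lambda>_. 1)" by (auto simp: h_def)
      with False show ?thesis by (auto simp: axes_law_def density_1 prod_eq_iff)
    qed
    show "h v \<in> borel_measurable (axes_law a b v)"
    proof -
      have "(\<lambda>x. ennreal ((1 - b) / a * exp (\<theta> * x))) \<in> borel_measurable borel" by measurable
      then have "h v \<in> borel_measurable borel"
        unfolding h_def[abs_def] by (cases "0 < fst v \<and> snd v = 0") auto
      then show ?thesis by (simp cong: measurable_cong_sets)
    qed
  qed unfold_locales
  have prod_h: "(\<Prod>v\<in>K. h v (\<eta> v)) = ennreal (((1 - b) / a) ^ m) * (\<Prod>i\<in>{1..m}. ennreal (exp (\<theta> * \<eta> (i, 0))))" for \<eta>
  proof -
    have "(\<Prod>v\<in>K. h v (\<eta> v)) = (\<Prod>v\<in>(\<lambda>i. (i, 0)) ` {1..m}. h v (\<eta> v))"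
      by (rule prod.mono_neutral_right) (auto simp: K_def h_def)
    also have "\<dots> = (\<Prod>i\<in>{1..m}. ennreal ((1 - b) / a) * ennreal (exp (\<theta> * \<eta> (i, 0))))"
      using a b by (subst prod.reindex) (auto simp: inj_on_def h_def simp flip: ennreal_mult' intro!: prod.cong)
    finally show ?thesis
      using a b by (simp add: prod.distrib ennreal_power)
  qed
  have h_meas [measurable]: "(\<lambda>\<eta>. \<Prod>v\<in>K. h v (\<eta> v)) \<in> borel_measurable (PiM K (\<lambda>_. borel))"
    unfolding h_def by (intro borel_measurable_prod_ennreal measurable_compose[OF comp]) auto
  have f_sweep: "(\<lambda>\<eta>. f (sweep n m \<eta>)) \<in> borel_measurable (PiM K (\<lambda>_. borel))"
    using measurable_compose[OF measurable_sweep f[unfolded K_def], of m] by (simp add: K_def)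
  have "ennreal (exp (\<theta> * G_stat \<eta> (m, n))) =
      ennreal ((a / (1 - b)) ^ m) * ((\<Prod>v\<in>K. h v (\<eta> v)) * f (sweep n m \<eta>))" for \<eta>
  proof -
    have "ennreal (exp (\<theta> * G_stat \<eta> (m, n))) =
       (\<Prod>i\<in>{1..m}. ennreal (exp (\<theta> * \<eta> (i, 0)))) * f (sweep n m \<eta>)"
      by (simp add: G_stat_eq_sweep f_def distrib_left exp_add sum_distrib_left exp_sum ennreal_mult prod_ennreal prod_nonneg)
    moreover have "ennreal ((a / (1 - b)) ^ m) * ennreal (((1 - b) / a) ^ m) = 1"
      using a b by (simp add: ennreal_mult[symmetric] power_mult_distrib[symmetric])
    ultimately show ?thesis
      by (simp add: prod_h mult.assoc[symmetric])
  qed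
  then have "(\<integral>\<^sup>+\<eta>. ennreal (exp (\<theta> * G_stat \<eta> (m, n))) \<partial>PiM K (axes_law a b)) =
      ennreal ((a / (1 - b)) ^ m) * (\<integral>\<^sup>+\<eta>. (\<Prod>v\<in>K. h v (\<eta> v)) * f (sweep n m \<eta>) \<partial>PiM K (axes_law a b))"
    using h_meas f_sweep by (simp add: nn_integral_cmult cong: measurable_cong_sets add: sets_PiM_axes_law)
  also have "(\<integral>\<^sup>+\<eta>. (\<Prod>v\<in>K. h v (\<eta> v)) * f (sweep n m \<eta>) \<partial>PiM K (axes_law a b)) =
      (\<integral>\<^sup>+\<eta>. f (sweep n m \<eta>) \<partial>PiM K (axes_law (1 - b) b))"
    unfolding tilt[symmetric] using h_meas f_sweep
    by (intro nn_integral_density[symmetric]) (simp_all cong: measurable_cong_sets add: sets_PiM_axes_law)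
  also have "\<dots> = (\<integral>\<^sup>+\<eta>. f \<eta> \<partial>PiM K (axes_law (1 - b) b))"
    using nn_integral_sweep[of "1 - b" m m f n] f b by (simp add: K_def)
  also have "\<dots> = ennreal ((b / (1 - a)) ^ n)"
  proof -
    define k :: "vertex \<Rightarrow> real \<Rightarrow> ennreal" where "k v x = (if fst v = 0 then ennreal (exp (\<theta> * x)) else 1)" for v x
    have row: "(\<Prod>v\<in>K. if fst v = 0 then q (snd v) else 1) = (\<Prod>j\<in>{0..n}. q j)" for q :: "nat \<Rightarrow> ennreal"
    proof -
      have "(\<Prod>v\<in>K. if fst v = 0 then q (snd v) else 1) = (\<Prod>v\<in>Pair (0::nat) ` {0..n}. if fst v = 0 then q (snd v) else 1)"
        by (rule prod.mono_neutral_right) (auto simp: K_def)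
      then show ?thesis by (simp add: prod.reindex inj_on_def)
    qed
    have "f \<eta> = (\<Prod>v\<in>K. k v (\<eta> v))" for \<eta>
      unfolding f_def row[symmetric] k_def by (intro prod.cong) auto
    moreover have "k v \<in> borel_measurable (axes_law (1 - b) b v)" for v
    proof -
      have "k v \<in> borel_measurable borel"
        unfolding k_def[abs_def] by (cases "fst v = 0") auto
      then show ?thesis by (simp cong: measurable_cong_sets)
    qed
    ultimately have "(\<integral>\<^sup>+\<eta>. f \<eta> \<partial>PiM K (axes_law (1 - b) b)) = (\<Prod>v\<in>K. \<integral>\<^sup>+x. k v x \<partial>axes_law (1 - b) b v)"
      using K by (simp add: product_nn_integral_prod)
    also have "\<dots> = (\<Prod>v\<in>K. if fst v = 0 then (if snd v = 0 then 1 else ennreal (b / (1 - a))) else 1)"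
    proof (rule prod.cong)
      fix v
      have "(\<integral>\<^sup>+x. k v x \<partial>axes_law (1 - b) b v) = 1" if "fst v \<noteq> 0"
        using that prob_space.emeasure_space_1[OF prob_space[of v]] by (simp add: k_def)
      moreover have "(\<integral>\<^sup>+x. k v x \<partial>axes_law (1 - b) b v) = 1" if "v = (0, 0)"
        using that by (simp add: k_def axes_law_def nn_integral_return)
      moreover have "(\<integral>\<^sup>+x. k v x \<partial>axes_law (1 - b) b v) = ennreal (b / (1 - a))" if "fst v = 0" "snd v \<noteq> 0"
        using that nn_integral_exp_law_exp[of b \<theta>] a b \<theta> by (auto simp: k_def axes_law_def)
      ultimately show "(\<integral>\<^sup>+x. k v x \<partial>axes_law (1 - b) b v) =
          (if fst v = 0 then (if snd v = 0 then 1 else ennreal (b / (1 - a))) else 1)"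
        by (auto simp: prod_eq_iff)
    qed simp
    also have "\<dots> = (\<Prod>j\<in>{0..n}. if j = 0 then 1 else ennreal (b / (1 - a)))"
      by (rule row)
    also have "\<dots> = ennreal ((b / (1 - a)) ^ n)"
      using a b by (simp add: prod.atLeast_Suc_atMost ennreal_power)
    finally show ?thesis .
  qed
  finally show ?thesis
    using a b by (simp add: K_def \<theta>_def ennreal_mult)
qed

lemma measurable_restrict_scale_axes:
  "(\<lambda>\<omega>. \<lambda>v\<in>K. scale_axes s t \<omega> v) \<in> measurable (stat_measure \<rho>) (PiM K (\<lambda>_. borel))"
proof (rule measurable_restrict)
  fix v
  show "(\<lambda>\<omega>. scale_axes s t \<omega> v) \<in> borel_measurable (stat_measure \<rho>)"
    unfolding scale_axes_def by measurable
qed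

lemma G_stat_restrict: "G_stat (\<lambda>v\<in>{..m} \<times> {..n}. \<omega> v) (m, n) = G_stat \<omega> (m, n)"
  by (rule G_stat_cong) simp

lemma borel_measurable_G_stat_scale_axes [measurable]:
  "(\<lambda>\<omega>. G_stat (scale_axes s t \<omega>) (m, n)) \<in> borel_measurable (stat_measure \<rho>)"
  using measurable_compose[OF measurable_restrict_scale_axes borel_measurable_G_stat_PiM[OF order_refl order_refl]]
  by (simp only: G_stat_restrict)

lemma nn_integral_exp_G_scaled:
  assumes \<rho>: "0 < \<rho>" "\<rho> < 1" and st: "0 < s" "0 < t" and "(1 - \<rho>) / s = a" "\<rho> / t = b" "a < 1" "b < 1"
  shows "(\<integral>\<^sup>+\<omega>. ennreal (exp ((a + b - 1) * G_stat (scale_axes s t \<omega>) (m, n))) \<partial>stat_measure \<rho>) =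
    ennreal ((a / (1 - b)) ^ m * (b / (1 - a)) ^ n)"
proof -
  define K where "K = {..m} \<times> {..n}"
  note [measurable] = measurable_restrict_scale_axes[where K = K]
  have [measurable]: "(\<lambda>\<omega>. G_stat \<omega> (m, n)) \<in> borel_measurable (PiM K (\<lambda>_. borel))"
    unfolding K_def by (rule borel_measurable_G_stat_PiM) auto
  have restrict: "G_stat (restrict \<omega> K) (m, n) = G_stat \<omega> (m, n)" for \<omega>
    unfolding K_def by (rule G_stat_restrict)
  have "(\<integral>\<^sup>+\<omega>. ennreal (exp ((a + b - 1) * G_stat (scale_axes s t \<omega>) (m, n))) \<partial>stat_measure \<rho>) =
      (\<integral>\<^sup>+\<eta>. ennreal (exp ((a + b - 1) * G_stat \<eta> (m, n)))
         \<partial>distr (stat_measure \<rho>) (PiM K (\<lambda>_. borel)) (\<lambda>\<omega>. \<lambda>v\<in>K. scale_axes s t \<omega> v))"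
    by (simp add: nn_integral_distr restrict)
  also have "distr (stat_measure \<rho>) (PiM K (\<lambda>_. borel)) (\<lambda>\<omega>. \<lambda>v\<in>K. scale_axes s t \<omega> v) = PiM K (axes_law a b)"
    unfolding assms(5,6)[symmetric] by (rule distr_scale_axes) (use assms in \<open>auto simp: K_def\<close>)
  also have "(\<integral>\<^sup>+\<eta>. ennreal (exp ((a + b - 1) * G_stat \<eta> (m, n))) \<partial>PiM K (axes_law a b)) =
      ennreal ((a / (1 - b)) ^ m * (b / (1 - a)) ^ n)"
    unfolding K_def by (rule nn_integral_exp_G_stat) (use assms in auto)
  finally show ?thesis .
qed

lemma AE_weight_nonneg:
  assumes "0 < \<rho>" "\<rho> < 1"
  shows "AE \<omega> in stat_measure \<rho>. \<omega> (0, 0) = 0 \<and> (\<forall>v. 0 \<le> \<omega> v)"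
proof -
  have AE_weight: "AE \<omega> in stat_measure \<rho>. P (\<omega> v)" if "AE x in weight_law \<rho> v. P x" for P v
    using that[folded distr_weight[OF assms]] by (rule AE_distrD[OF measurable_weight])
  have exp_nonneg: "AE x in exp_law l. 0 \<le> x" for l
    by (subst AE_density) (auto simp: exponential_density_def intro!: AE_I2)
  have law: "weight_law \<rho> (0, 0) = return borel 0"
    "weight_law \<rho> v = return borel 0 \<or> (\<exists>l. weight_law \<rho> v = exp_law l)" for v
    by (auto simp: weight_law_def)
  have zero: "AE x in return borel 0. x = (0 :: real)"
    by (subst AE_return) auto
  have "AE x in weight_law \<rho> v. 0 \<le> x" for v
    using law(2)[of v]
  proof (elim disjE exE)
    assume eq: "weight_law \<rho> v = return borel 0"
    from zero show ?thesis unfolding eq by eventually_elim simp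
  next
    fix l assume eq: "weight_law \<rho> v = exp_law l"
    show ?thesis unfolding eq by (rule exp_nonneg)
  qed
  then have "AE \<omega> in stat_measure \<rho>. \<forall>v. 0 \<le> \<omega> v"
    by (subst AE_all_countable) (auto intro: AE_weight)
  moreover have "AE \<omega> in stat_measure \<rho>. \<omega> (0, 0) = 0"
    by (rule AE_weight) (unfold law(1), rule zero)
  ultimately show ?thesis by eventually_elim simp
qed

section \<open>Exponential moments at the characteristic point\<close>

lemma ln_one_plus_bounds:
  fixes x :: real
  assumes "0 \<le> x"
  shows "x - x\<^sup>2 / 2 \<le> ln (1 + x)" "ln (1 + x) \<le> x - x\<^sup>2 / 2 + x ^ 3 / 3"
proof -
  have "(\<lambda>x::real. ln (1 + x) - (x - x\<^sup>2 / 2)) 0 \<le> (\<lambda>x. ln (1 + x) - (x - x\<^sup>2 / 2)) x"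
  proof (rule DERIV_nonneg_imp_nondecreasing[OF assms])
    fix t :: real assume t: "0 \<le> t" "t \<le> x"
    have "((\<lambda>x. ln (1 + x) - (x - x\<^sup>2 / 2)) has_real_derivative t\<^sup>2 / (1 + t)) (at t)"
      using t by (auto intro!: derivative_eq_intros simp: field_simps power2_eq_square)
    then show "\<exists>y. ((\<lambda>x. ln (1 + x) - (x - x\<^sup>2 / 2)) has_real_derivative y) (at t) \<and> 0 \<le> y"
      using t by (intro exI[of _ "t\<^sup>2 / (1 + t)"]) auto
  qed
  then show "x - x\<^sup>2 / 2 \<le> ln (1 + x)" by simp
  have "(\<lambda>x::real. x - x\<^sup>2 / 2 + x ^ 3 / 3 - ln (1 + x)) 0 \<le> (\<lambda>x. x - x\<^sup>2 / 2 + x ^ 3 / 3 - ln (1 + x)) x"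
  proof (rule DERIV_nonneg_imp_nondecreasing[OF assms])
    fix t :: real assume t: "0 \<le> t" "t \<le> x"
    have "((\<lambda>x. x - x\<^sup>2 / 2 + x ^ 3 / 3 - ln (1 + x)) has_real_derivative t ^ 3 / (1 + t)) (at t)"
      using t by (auto intro!: derivative_eq_intros simp: field_simps power2_eq_square power3_eq_cube)
    then show "\<exists>y. ((\<lambda>x. x - x\<^sup>2 / 2 + x ^ 3 / 3 - ln (1 + x)) has_real_derivative y) (at t) \<and> 0 \<le> y"
      using t by (intro exI[of _ "t ^ 3 / (1 + t)"]) auto
  qed
  then show "ln (1 + x) \<le> x - x\<^sup>2 / 2 + x ^ 3 / 3" by simp
qed

lemma ln_one_minus_bounds:
  fixes x :: real
  assumes "0 \<le> x" "x \<le> 1 / 2"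
  shows "x + x\<^sup>2 / 2 + x ^ 3 / 3 \<le> - ln (1 - x)" "- ln (1 - x) \<le> x + x\<^sup>2 / 2 + x ^ 3"
proof -
  have "(\<lambda>x::real. - ln (1 - x) - (x + x\<^sup>2 / 2 + x ^ 3 / 3)) 0 \<le> (\<lambda>x. - ln (1 - x) - (x + x\<^sup>2 / 2 + x ^ 3 / 3)) x"
  proof (rule DERIV_nonneg_imp_nondecreasing[OF assms(1)])
    fix t :: real assume t: "0 \<le> t" "t \<le> x"
    have "((\<lambda>x. - ln (1 - x) - (x + x\<^sup>2 / 2 + x ^ 3 / 3)) has_real_derivative t ^ 3 / (1 - t)) (at t)"
      using t assms by (auto intro!: derivative_eq_intros simp: field_simps power2_eq_square power3_eq_cube)
    then show "\<exists>y. ((\<lambda>x. - ln (1 - x) - (x + x\<^sup>2 / 2 + x ^ 3 / 3)) has_real_derivative y) (at t) \<and> 0 \<le> y"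
      using t assms by (intro exI[of _ "t ^ 3 / (1 - t)"]) auto
  qed
  then show "x + x\<^sup>2 / 2 + x ^ 3 / 3 \<le> - ln (1 - x)" by simp
  have "(\<lambda>x::real. x + x\<^sup>2 / 2 + x ^ 3 + ln (1 - x)) 0 \<le> (\<lambda>x. x + x\<^sup>2 / 2 + x ^ 3 + ln (1 - x)) x"
  proof (rule DERIV_nonneg_imp_nondecreasing[OF assms(1)])
    fix t :: real assume t: "0 \<le> t" "t \<le> x"
    have "((\<lambda>x. x + x\<^sup>2 / 2 + x ^ 3 + ln (1 - x)) has_real_derivative t\<^sup>2 * (2 - 3 * t) / (1 - t)) (at t)"
      using t assms by (auto intro!: derivative_eq_intros simp: field_simps power2_eq_square power3_eq_cube)
    moreover have "0 \<le> t\<^sup>2 * (2 - 3 * t) / (1 - t)" using t assms by auto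
    ultimately show "\<exists>y. ((\<lambda>x. x + x\<^sup>2 / 2 + x ^ 3 + ln (1 - x)) has_real_derivative y) (at t) \<and> 0 \<le> y"
      by blast
  qed
  then show "- ln (1 - x) \<le> x + x\<^sup>2 / 2 + x ^ 3" by simp
qed

text \<open>
  The weights \<open>p\<^sup>2\<close> and \<open>q\<^sup>2\<close> are those of the characteristic direction: they turn the linear terms
  of the two logarithms into \<open>(p + q) \<theta> = \<theta>\<close> and make the quadratic terms \<open>\<theta>\<^sup>2 / 2\<close> and
  \<open>- \<theta>\<^sup>2 / 2\<close> cancel, so the deviation from \<open>\<theta>\<close> is of third order.
\<close>
lemma boundary_exponent_bounds:
  fixes p q \<theta> :: real
  assumes pq: "0 < p" "0 < q" "p + q = 1" and \<theta>: "0 \<le> \<theta>" "\<theta> \<le> p / 2"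
  shows "\<theta> + \<theta> ^ 3 / 3 \<le> p\<^sup>2 * ln (p / (p - \<theta>)) + q\<^sup>2 * ln ((q + \<theta>) / q)" (is "_ \<le> ?E")
    and "p\<^sup>2 * ln (p / (p - \<theta>)) + q\<^sup>2 * ln ((q + \<theta>) / q) \<le> \<theta> + (1 / p + 1 / q) * \<theta> ^ 3"
proof -
  have p: "ln (p / (p - \<theta>)) = - ln (1 - \<theta> / p)"
    using pq \<theta> by (subst ln_inverse[symmetric]) (auto simp: field_simps)
  have q: "ln ((q + \<theta>) / q) = ln (1 + \<theta> / q)"
    using pq by (simp add: add_divide_distrib)
  have x: "0 \<le> \<theta> / p" "\<theta> / p \<le> 1 / 2" "0 \<le> \<theta> / q"
    using pq \<theta> by (auto simp: field_simps)
  note bounds = ln_one_minus_bounds[OF x(1,2)] ln_one_plus_bounds[OF x(3)]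
  have "p\<^sup>2 * (\<theta> / p + (\<theta> / p)\<^sup>2 / 2 + (\<theta> / p) ^ 3 / 3) + q\<^sup>2 * (\<theta> / q - (\<theta> / q)\<^sup>2 / 2) \<le> ?E"
    unfolding p q by (intro add_mono mult_left_mono bounds) auto
  moreover have "p\<^sup>2 * (\<theta> / p + (\<theta> / p)\<^sup>2 / 2 + (\<theta> / p) ^ 3 / 3) + q\<^sup>2 * (\<theta> / q - (\<theta> / q)\<^sup>2 / 2)
      = (p + q) * \<theta> + \<theta> ^ 3 / (3 * p)"
    using pq(1,2) by (simp add: field_simps power2_eq_square power3_eq_cube)
  moreover have "\<theta> ^ 3 / 3 \<le> \<theta> ^ 3 / (3 * p)"
    using pq \<theta> by (intro divide_left_mono) auto
  ultimately show "\<theta> + \<theta> ^ 3 / 3 \<le> ?E"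
    using pq(3) by simp
  have "?E \<le> p\<^sup>2 * (\<theta> / p + (\<theta> / p)\<^sup>2 / 2 + (\<theta> / p) ^ 3) + q\<^sup>2 * (\<theta> / q - (\<theta> / q)\<^sup>2 / 2 + (\<theta> / q) ^ 3 / 3)"
    unfolding p q by (intro add_mono mult_left_mono bounds) auto
  also have "\<dots> = (p + q) * \<theta> + (1 / p + 1 / (3 * q)) * \<theta> ^ 3"
    using pq(1,2) by (simp add: field_simps power2_eq_square power3_eq_cube)
  also have "\<dots> \<le> \<theta> + (1 / p + 1 / q) * \<theta> ^ 3"
    using pq \<theta> by (intro add_mono mult_right_mono) (auto simp: field_simps)
  finally show "?E \<le> \<theta> + (1 / p + 1 / q) * \<theta> ^ 3" .
qed

text \<open>
  Rounding the characteristic point down lowers each exponent by at most one, and both bases lie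
  between \<open>1\<close> and \<open>2\<close>; this accounts for the factor \<open>1 / 4\<close>.
\<close>
lemma boundary_mgf_bounds:
  fixes p q \<theta> :: real
  assumes pq: "0 < p" "0 < q" "p + q = 1" and \<theta>: "0 \<le> \<theta>" "\<theta> \<le> p / 2" "\<theta> \<le> q"
    and m: "real m \<le> p\<^sup>2 * N" "p\<^sup>2 * N \<le> real m + 1" and n: "real n \<le> q\<^sup>2 * N" "q\<^sup>2 * N \<le> real n + 1"
    and N: "0 \<le> N"
  shows "exp (N * \<theta> + N * \<theta> ^ 3 / 3) / 4 \<le> (p / (p - \<theta>)) ^ m * ((q + \<theta>) / q) ^ n"
    and "(p / (p - \<theta>)) ^ m * ((q + \<theta>) / q) ^ n \<le> exp (N * \<theta> + (1 / p + 1 / q) * (N * \<theta> ^ 3))"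
proof -
  define x y where "x = ln (p / (p - \<theta>))" and "y = ln ((q + \<theta>) / q)"
  have pos: "0 < p / (p - \<theta>)" "0 < (q + \<theta>) / q"
    using pq \<theta> by auto
  have xy: "0 \<le> x" "0 \<le> y" "x \<le> ln 2" "y \<le> ln 2"
    unfolding x_def y_def using pq \<theta> by (auto intro!: ln_ge_zero simp: field_simps)
  have "(p / (p - \<theta>)) ^ m * ((q + \<theta>) / q) ^ n = exp (real m * x) * exp (real n * y)"
    using pos by (simp add: x_def y_def exp_of_nat_mult)
  then have eq: "(p / (p - \<theta>)) ^ m * ((q + \<theta>) / q) ^ n = exp (real m * x + real n * y)"
    by (simp add: exp_add)
  note E = boundary_exponent_bounds[OF pq \<theta>(1,2), folded x_def y_def]
  have "real m * x + real n * y \<le> (p\<^sup>2 * N) * x + (q\<^sup>2 * N) * y"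
    using m n xy by (intro add_mono mult_right_mono)
  also have "\<dots> = N * (p\<^sup>2 * x + q\<^sup>2 * y)" by (simp add: algebra_simps)
  also have "\<dots> \<le> N * (\<theta> + (1 / p + 1 / q) * \<theta> ^ 3)"
    using E N by (intro mult_left_mono)
  finally show "(p / (p - \<theta>)) ^ m * ((q + \<theta>) / q) ^ n \<le> exp (N * \<theta> + (1 / p + 1 / q) * (N * \<theta> ^ 3))"
    unfolding eq by (simp add: algebra_simps)
  have "N * (\<theta> + \<theta> ^ 3 / 3) \<le> N * (p\<^sup>2 * x + q\<^sup>2 * y)"
    using E N by (intro mult_left_mono)
  also have "\<dots> = (p\<^sup>2 * N) * x + (q\<^sup>2 * N) * y" by (simp add: algebra_simps)
  also have "\<dots> \<le> (real m + 1) * x + (real n + 1) * y"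
    using m n xy by (intro add_mono mult_right_mono)
  also have "\<dots> \<le> real m * x + real n * y + 2 * ln 2"
    using xy by (simp add: algebra_simps)
  finally have "exp (N * (\<theta> + \<theta> ^ 3 / 3)) \<le> exp (real m * x + real n * y + (ln 2 + ln 2))"
    by simp
  also have "\<dots> = exp (real m * x + real n * y) * 4"
    by (simp only: exp_add exp_ln)
  finally show "exp (N * \<theta> + N * \<theta> ^ 3 / 3) / 4 \<le> (p / (p - \<theta>)) ^ m * ((q + \<theta>) / q) ^ n"
    unfolding eq by (simp add: algebra_simps)
qed

lemma char_point_bounds:
  "char_point \<rho> N = (m, n) \<Longrightarrow> real m \<le> (1 - \<rho>)\<^sup>2 * N \<and> (1 - \<rho>)\<^sup>2 * N \<le> real m + 1 \<and>
     real n \<le> \<rho>\<^sup>2 * N \<and> \<rho>\<^sup>2 * N \<le> real n + 1"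
  unfolding char_point_def using real_of_int_floor_add_one_ge by auto

text \<open>
  The map \<open>T\<close> raises the rate of the vertical axis to \<open>\<rho> + \<theta>\<close> and \<open>T'\<close> that of the horizontal
  axis to \<open>1 - \<rho> + \<theta>\<close>; in both cases the two boundary rates add up to \<open>1 + \<theta>\<close>, so the
  exponential moment of parameter \<open>\<theta>\<close> is explicit. The lower bound needs \<open>T\<close> alone, the upper bound
  is the sum of the two moments.
\<close>
lemma moment_bounds:
  assumes \<rho>: "0 < \<rho>" "\<rho> < 1" and \<theta>: "0 < \<theta>" "\<theta> \<le> min \<rho> (1 - \<rho>) / 2"
  shows "ennreal (exp (real N * \<theta> ^ 3 / 3) / 4) \<le>
      (\<integral>\<^sup>+\<omega>. ennreal (exp (\<theta> * (G_stat \<omega> (char_point \<rho> N) - N))) \<partial>stat_measure \<rho>)" (is "_ \<le> ?I")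
    and "(\<integral>\<^sup>+\<omega>. ennreal (exp (\<theta> * (G_stat \<omega> (char_point \<rho> N) - N))) \<partial>stat_measure \<rho>) \<le>
      ennreal (2 * exp ((1 / \<rho> + 1 / (1 - \<rho>)) * (real N * \<theta> ^ 3)))"
proof -
  obtain m n where mn: "char_point \<rho> N = (m, n)" by (cases "char_point \<rho> N")
  define T where "T = (scale_axes 1 (\<rho> / (\<rho> + \<theta>)) :: _ \<Rightarrow> vertex \<Rightarrow> real)"
  define T' where "T' = (scale_axes ((1 - \<rho>) / (1 - \<rho> + \<theta>)) 1 :: _ \<Rightarrow> vertex \<Rightarrow> real)"
  define U where "U = exp (- \<theta> * N)"
  have bounds: "real m \<le> (1 - \<rho>)\<^sup>2 * N" "(1 - \<rho>)\<^sup>2 * N \<le> real m + 1"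
     "real n \<le> \<rho>\<^sup>2 * N" "\<rho>\<^sup>2 * N \<le> real n + 1"
    using char_point_bounds[OF mn] by auto
  have T: "(\<integral>\<^sup>+\<omega>. ennreal (exp (\<theta> * G_stat (T \<omega>) (m, n))) \<partial>stat_measure \<rho>) =
      ennreal (((1 - \<rho>) / (1 - \<rho> - \<theta>)) ^ m * ((\<rho> + \<theta>) / \<rho>) ^ n)"
  proof -
    have "\<rho> / (\<rho> / (\<rho> + \<theta>)) = \<rho> + \<theta>" "1 - (\<rho> + \<theta>) = 1 - \<rho> - \<theta>" "1 - \<rho> + (\<rho> + \<theta>) - 1 = \<theta>" "1 - (1 - \<rho>) = \<rho>"
      using \<rho> by simp_all
    then show ?thesis
      using nn_integral_exp_G_scaled[OF \<rho>, of 1 "\<rho> / (\<rho> + \<theta>)" "1 - \<rho>" "\<rho> + \<theta>" m n] \<rho> \<theta>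
      unfolding T_def by (simp add: diff_diff_eq)
  qed
  have T': "(\<integral>\<^sup>+\<omega>. ennreal (exp (\<theta> * G_stat (T' \<omega>) (m, n))) \<partial>stat_measure \<rho>) =
      ennreal ((\<rho> / (\<rho> - \<theta>)) ^ n * ((1 - \<rho> + \<theta>) / (1 - \<rho>)) ^ m)"
  proof -
    have "(1 - \<rho>) / ((1 - \<rho>) / (1 - \<rho> + \<theta>)) = 1 - \<rho> + \<theta>" "1 - (1 - \<rho> + \<theta>) = \<rho> - \<theta>" "1 - \<rho> + \<theta> + \<rho> - 1 = \<theta>"
      using \<rho> by simp_all
    then show ?thesis
      using nn_integral_exp_G_scaled[OF \<rho>, of "(1 - \<rho>) / (1 - \<rho> + \<theta>)" 1 "1 - \<rho> + \<theta>" \<rho> m n] \<rho> \<theta>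
      unfolding T'_def by (simp add: mult.commute)
  qed
  note B = boundary_mgf_bounds[of "1 - \<rho>" \<rho> \<theta> m "real N" n] and
    B' = boundary_mgf_bounds[of \<rho> "1 - \<rho>" \<theta> n "real N" m]
  have shift: "?I = ennreal U * (\<integral>\<^sup>+\<omega>. ennreal (exp (\<theta> * G_stat \<omega> (m, n))) \<partial>stat_measure \<rho>)"
    unfolding mn by (subst nn_integral_cmult[symmetric])
      (auto simp: U_def right_diff_distrib exp_diff exp_minus field_simps simp flip: ennreal_mult' intro!: nn_integral_cong)
  have "ennreal (exp (real N * \<theta> + real N * \<theta> ^ 3 / 3) / 4) \<le>
      (\<integral>\<^sup>+\<omega>. ennreal (exp (\<theta> * G_stat (T \<omega>) (m, n))) \<partial>stat_measure \<rho>)"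
    unfolding T by (intro ennreal_leI B(1)) (use bounds \<rho> \<theta> in auto)
  also have "\<dots> \<le> (\<integral>\<^sup>+\<omega>. ennreal (exp (\<theta> * G_stat \<omega> (m, n))) \<partial>stat_measure \<rho>)"
  proof (rule nn_integral_mono_AE)
    show "AE \<omega> in stat_measure \<rho>. ennreal (exp (\<theta> * G_stat (T \<omega>) (m, n))) \<le> ennreal (exp (\<theta> * G_stat \<omega> (m, n)))"
      using AE_weight_nonneg[OF \<rho>]
    proof eventually_elim
      case (elim \<omega>)
      then have "G_stat (T \<omega>) (m, n) \<le> G_stat \<omega> (m, n)"
        unfolding T_def using \<rho> \<theta> by (intro G_stat_scale_axes_le) auto
      then show ?case using \<theta> by (simp add: ennreal_leI)
    qed
  qed
  finally have "ennreal U * ennreal (exp (real N * \<theta> + real N * \<theta> ^ 3 / 3) / 4) \<le> ?I"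
    unfolding shift by (rule mult_left_mono) simp
  then show "ennreal (exp (real N * \<theta> ^ 3 / 3) / 4) \<le> ?I"
    by (simp add: U_def mult.commute flip: ennreal_mult' exp_add)
  have "(\<integral>\<^sup>+\<omega>. ennreal (exp (\<theta> * G_stat \<omega> (m, n))) \<partial>stat_measure \<rho>) \<le>
     (\<integral>\<^sup>+\<omega>. ennreal (exp (\<theta> * G_stat (T \<omega>) (m, n))) + ennreal (exp (\<theta> * G_stat (T' \<omega>) (m, n))) \<partial>stat_measure \<rho>)"
  proof (rule nn_integral_mono_AE)
    show "AE \<omega> in stat_measure \<rho>. ennreal (exp (\<theta> * G_stat \<omega> (m, n))) \<le>
        ennreal (exp (\<theta> * G_stat (T \<omega>) (m, n))) + ennreal (exp (\<theta> * G_stat (T' \<omega>) (m, n)))"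
      using AE_weight_nonneg[OF \<rho>]
    proof eventually_elim
      case (elim \<omega>)
      then have "G_stat \<omega> (m, n) \<le> max (G_stat (T \<omega>) (m, n)) (G_stat (T' \<omega>) (m, n))"
        unfolding T_def T'_def by (intro G_stat_le_max_scale_axes) simp
      then have "\<theta> * G_stat \<omega> (m, n) \<le> max (\<theta> * G_stat (T \<omega>) (m, n)) (\<theta> * G_stat (T' \<omega>) (m, n))"
        using \<theta> by (auto simp: max_def split: if_splits)
      then have "exp (\<theta> * G_stat \<omega> (m, n)) \<le> exp (\<theta> * G_stat (T \<omega>) (m, n)) + exp (\<theta> * G_stat (T' \<omega>) (m, n))"
        by (auto simp: le_max_iff_disj intro: add_increasing add_increasing2)
      then show ?case by (simp add: ennreal_leI flip: ennreal_plus)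
    qed
  qed
  also have "\<dots> = ennreal (((1 - \<rho>) / (1 - \<rho> - \<theta>)) ^ m * ((\<rho> + \<theta>) / \<rho>) ^ n) +
      ennreal ((\<rho> / (\<rho> - \<theta>)) ^ n * ((1 - \<rho> + \<theta>) / (1 - \<rho>)) ^ m)"
    unfolding T[symmetric] T'[symmetric] unfolding T_def T'_def by (rule nn_integral_add) measurable
  also have "\<dots> \<le> ennreal (exp (N * \<theta> + (1 / (1 - \<rho>) + 1 / \<rho>) * (N * \<theta> ^ 3))) +
      ennreal (exp (N * \<theta> + (1 / \<rho> + 1 / (1 - \<rho>)) * (N * \<theta> ^ 3)))"
    by (intro add_mono ennreal_leI B(2) B'(2)) (use bounds \<rho> \<theta> in auto)
  also have "\<dots> = ennreal (2 * exp (N * \<theta> + (1 / \<rho> + 1 / (1 - \<rho>)) * (N * \<theta> ^ 3)))"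
    by (simp add: add.commute flip: ennreal_plus)
  finally have "?I \<le> ennreal U * ennreal (2 * exp (N * \<theta> + (1 / \<rho> + 1 / (1 - \<rho>)) * (N * \<theta> ^ 3)))"
    unfolding shift by (rule mult_left_mono) simp
  also have "\<dots> = ennreal (2 * exp ((1 / \<rho> + 1 / (1 - \<rho>)) * (N * \<theta> ^ 3)))"
    by (simp add: U_def exp_add exp_minus field_simps flip: ennreal_mult')
  finally show "?I \<le> ennreal (2 * exp ((1 / \<rho> + 1 / (1 - \<rho>)) * (real N * \<theta> ^ 3)))" .
qed

section \<open>From exponential moments to tail bounds\<close>

lemma (in prob_space) exp_Markov:
  assumes [measurable]: "X \<in> borel_measurable M" and "0 \<le> \<theta>"
    and bound: "(\<integral>\<^sup>+x. ennreal (exp (\<theta> * X x)) \<partial>M) \<le> ennreal a" and "0 \<le> a"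
  shows "measure M {x \<in> space M. t \<le> X x} \<le> exp (- \<theta> * t) * a"
proof -
  have "ennreal (exp (\<theta> * t)) * emeasure M {x \<in> space M. t \<le> X x} =
      (\<integral>\<^sup>+x. ennreal (exp (\<theta> * t)) * indicator {x \<in> space M. t \<le> X x} x \<partial>M)"
    by (simp add: nn_integral_cmult_indicator)
  also have "\<dots> \<le> (\<integral>\<^sup>+x. ennreal (exp (\<theta> * X x)) \<partial>M)"
    using assms(2) by (intro nn_integral_mono) (auto simp: indicator_def intro!: ennreal_leI mult_left_mono)
  finally have "ennreal (exp (\<theta> * t) * measure M {x \<in> space M. t \<le> X x}) \<le> ennreal a"
    using bound by (simp add: emeasure_eq_measure ennreal_mult')
  then have "exp (\<theta> * t) * measure M {x \<in> space M. t \<le> X x} \<le> a"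
    using assms(4) by simp
  then show ?thesis
    by (simp add: exp_minus field_simps)
qed

text \<open>
  The part of the first moment below the threshold \<open>t\<close> is at most \<open>a / 2\<close>, so the part above it is
  at least \<open>a / 2\<close>; by the Cauchy-Schwarz inequality that part is controlled by the second moment
  and the probability of exceeding \<open>t\<close>.
\<close>
lemma (in prob_space) exp_Paley_Zygmund:
  assumes [measurable]: "X \<in> borel_measurable M" and "0 \<le> \<theta>"
    and lower: "ennreal a \<le> (\<integral>\<^sup>+x. ennreal (exp (\<theta> * X x)) \<partial>M)" and a: "2 * exp (\<theta> * t) \<le> a"
    and upper: "(\<integral>\<^sup>+x. ennreal (exp (2 * \<theta> * X x)) \<partial>M) \<le> ennreal b" and "0 < b"
  shows "a\<^sup>2 / (4 * b) \<le> measure M {x \<in> space M. t \<le> X x}"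
proof -
  define A where "A = {x \<in> space M. t \<le> X x}"
  have [measurable]: "A \<in> sets M" unfolding A_def by measurable
  have a0: "0 < a" using a by (rule less_le_trans[rotated]) simp
  have "ennreal a \<le> (\<integral>\<^sup>+x. ennreal (exp (\<theta> * X x)) \<partial>M)" by (rule lower)
  also have "\<dots> \<le> (\<integral>\<^sup>+x. ennreal (a / 2) + ennreal (exp (\<theta> * X x)) * indicator A x \<partial>M)"
  proof (rule nn_integral_mono)
    fix x assume x: "x \<in> space M"
    show "ennreal (exp (\<theta> * X x)) \<le> ennreal (a / 2) + ennreal (exp (\<theta> * X x)) * indicator A x"
    proof (cases "x \<in> A")
      case False
      with x have "exp (\<theta> * X x) \<le> exp (\<theta> * t)"
        using assms(2) by (auto simp: A_def intro!: mult_left_mono)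
      with a have "exp (\<theta> * X x) \<le> a / 2" by linarith
      with False show ?thesis by (simp add: ennreal_leI)
    qed simp
  qed
  also have "\<dots> = ennreal (a / 2) + (\<integral>\<^sup>+x. ennreal (exp (\<theta> * X x)) * indicator A x \<partial>M)"
    by (subst nn_integral_add) (auto simp: emeasure_space_1)
  finally have "ennreal (a / 2) + ennreal (a / 2) \<le> ennreal (a / 2) + (\<integral>\<^sup>+x. ennreal (exp (\<theta> * X x)) * indicator A x \<partial>M)"
    using a0 by (simp flip: ennreal_plus)
  then have "ennreal (a / 2) \<le> (\<integral>\<^sup>+x. ennreal (exp (\<theta> * X x)) * indicator A x \<partial>M)"
    by simp
  then have "ennreal (a / 2) ^ 2 \<le> (\<integral>\<^sup>+x. ennreal (exp (\<theta> * X x)) * indicator A x \<partial>M) ^ 2"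
    by (rule power_mono) simp
  also have "\<dots> \<le> (\<integral>\<^sup>+x. ennreal (exp (\<theta> * X x)) ^ 2 \<partial>M) * (\<integral>\<^sup>+x. indicator A x ^ 2 \<partial>M)"
    by (rule Cauchy_Schwarz_nn_integral) measurable
  also have "(\<lambda>x. ennreal (exp (\<theta> * X x)) ^ 2) = (\<lambda>x. ennreal (exp (2 * \<theta> * X x)))"
    by (simp add: ennreal_power fun_eq_iff mult.assoc exp_double)
  also have "(\<integral>\<^sup>+x. indicator A x ^ 2 \<partial>M) = ennreal (measure M A)"
  proof -
    have "(\<lambda>x. indicator A x ^ 2 :: ennreal) = indicator A"
      by (auto simp: indicator_def fun_eq_iff)
    then show ?thesis by (simp add: emeasure_eq_measure)
  qed
  also have "(\<integral>\<^sup>+x. ennreal (exp (2 * \<theta> * X x)) \<partial>M) * ennreal (measure M A) \<le> ennreal b * ennreal (measure M A)"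
    using upper by (rule mult_right_mono) simp
  finally have "ennreal ((a / 2)\<^sup>2) \<le> ennreal (b * measure M A)"
    using a0 assms(6) by (simp add: ennreal_power ennreal_mult)
  then have "(a / 2)\<^sup>2 \<le> b * measure M A"
    using assms(6) by (subst (asm) ennreal_le_iff) auto
  then show ?thesis
    using assms(6) by (simp add: A_def field_simps)
qed

lemma G_stat_ge_first_weight:
  assumes "\<And>v. 0 \<le> \<omega> v" "0 < i"
  shows "\<omega> (1, 0) \<le> G_stat \<omega> (i, j)"
proof -
  have nonneg: "0 \<le> G_stat \<omega> (i, j)" for i j
    by (induction i j rule: lattice_induct) (auto simp: assms(1) le_max_iff_disj intro!: add_nonneg_nonneg)
  have "0 < i \<longrightarrow> \<omega> (1, 0) \<le> G_stat \<omega> (i, j)"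
  proof (induction i j rule: lattice_induct)
    case (horizontal i)
    then show ?case using nonneg[of 0 0] assms(1)[of "(Suc i, 0)"] by (cases i) auto
  next
    case (bulk i j)
    then show ?case using assms(1)[of "(Suc i, Suc j)"] by (auto simp: max_def)
  qed auto
  with assms(2) show ?thesis by blast
qed

lemma prob_G_stat_ge_single_weight:
  assumes \<rho>: "0 < \<rho>" "\<rho> < 1" and "0 < m" "0 \<le> t"
  shows "exp (- (1 - \<rho>) * t) \<le> measure (stat_measure \<rho>) {\<omega> \<in> space (stat_measure \<rho>). t \<le> G_stat \<omega> (m, n)}"
proof -
  interpret prob_space "stat_measure \<rho>" by (rule prob_space_stat_measure) fact+
  have "distr (stat_measure \<rho>) lborel (\<lambda>\<omega>. \<omega> (1, 0)) = distr (stat_measure \<rho>) borel (\<lambda>\<omega>. \<omega> (1, 0))"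
    by (rule distr_cong) auto
  also have "\<dots> = exp_law (1 - \<rho>)"
    by (simp add: distr_weight[OF \<rho>] weight_law_def)
  finally have "distributed (stat_measure \<rho>) lborel (\<lambda>\<omega>. \<omega> (1, 0)) (exponential_density (1 - \<rho>))"
    unfolding distributed_def by auto
  from exponential_distributedD_gt[OF this assms(4)] \<rho>
  have "exp (- (1 - \<rho>) * t) = measure (stat_measure \<rho>) {\<omega> \<in> space (stat_measure \<rho>). t < \<omega> (1, 0)}"
    by (simp add: algebra_simps)
  also have "\<dots> \<le> measure (stat_measure \<rho>) {\<omega> \<in> space (stat_measure \<rho>). t \<le> G_stat \<omega> (m, n)}"
  proof (rule finite_measure_mono_AE)
    show "AE \<omega> in stat_measure \<rho>. \<omega> \<in> {\<omega> \<in> space (stat_measure \<rho>). t < \<omega> (1, 0)} \<longrightarrow>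
        \<omega> \<in> {\<omega> \<in> space (stat_measure \<rho>). t \<le> G_stat \<omega> (m, n)}"
      using AE_weight_nonneg[OF \<rho>]
    proof eventually_elim
      case (elim \<omega>)
      then show ?case using G_stat_ge_first_weight[of \<omega> m n] assms(3) by force
    qed
  qed measurable
  finally show ?thesis .
qed

text \<open>In the variables \<open>r\<close> and \<open>u\<close> all powers that occur in the tail bounds are integral.\<close>
lemma cube_root_scaling:
  fixes y :: real
  assumes "0 < N" "0 < y"
  defines "r \<equiv> real N powr (1/3)" and "u \<equiv> sqrt y"
  shows "0 < r" "0 < u" "real N = r ^ 3" "real N powr (2/3) = r\<^sup>2" "y = u\<^sup>2" "y powr (3/2) = u ^ 3"
proof -
  show "0 < r" "0 < u" "y = u\<^sup>2" using assms by auto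
  show "real N = r ^ 3" "real N powr (2/3) = r\<^sup>2"
    using assms by (auto simp: r_def powr_power)
  show "y powr (3/2) = u ^ 3"
    using assms by (simp add: u_def powr_half_sqrt[symmetric] powr_power)
qed

abbreviation upper_tail :: "real \<Rightarrow> nat \<Rightarrow> real \<Rightarrow> real" where
  "upper_tail \<rho> N t \<equiv> measure (stat_measure \<rho>)
     {\<omega> \<in> space (stat_measure \<rho>). G_stat \<omega> (char_point \<rho> N) - real N \<ge> t}"

lemma upper_tail_le:
  assumes \<rho>: "0 < \<rho>" "\<rho> < 1" and ru: "real N = r ^ 3" "0 < u" "u \<le> r"
    and \<kappa>: "0 < \<kappa>" "\<kappa> \<le> min \<rho> (1 - \<rho>) / 2" "(1 / \<rho> + 1 / (1 - \<rho>)) * \<kappa>\<^sup>2 \<le> 1 / 2"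
  shows "upper_tail \<rho> N (u\<^sup>2 * r) \<le> 2 * exp (- (\<kappa> / 2) * u ^ 3)"
proof -
  interpret prob_space "stat_measure \<rho>" by (rule prob_space_stat_measure) fact+
  \<comment> \<open>With this choice the exponent is \<open>(B \<kappa>\<^sup>2 - 1) \<kappa> u\<^sup>3\<close>, negative for small \<open>\<kappa>\<close>.\<close>
  define \<theta> where "\<theta> = \<kappa> * u / r"
  define B where "B = 1 / \<rho> + 1 / (1 - \<rho>)"
  have r: "0 < r" using ru by simp
  have \<theta>: "0 < \<theta>" "\<theta> \<le> \<kappa>"
    using ru \<kappa> r by (auto simp: \<theta>_def field_simps)
  have "upper_tail \<rho> N (u\<^sup>2 * r) \<le> exp (- \<theta> * (u\<^sup>2 * r)) * (2 * exp (B * (real N * \<theta> ^ 3)))"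
    unfolding B_def by (rule exp_Markov) (use \<theta> \<kappa> \<rho> in \<open>auto intro!: moment_bounds(2)\<close>)
  also have "\<dots> = 2 * exp (- \<theta> * (u\<^sup>2 * r) + B * (real N * \<theta> ^ 3))"
    by (subst exp_add) (rule mult.left_commute)
  also have "- \<theta> * (u\<^sup>2 * r) + B * (real N * \<theta> ^ 3) = (B * \<kappa>\<^sup>2 - 1) * (\<kappa> * u ^ 3)"
    using r by (simp add: \<theta>_def ru(1) field_simps power2_eq_square power3_eq_cube)
  also have "\<dots> \<le> (- 1 / 2) * (\<kappa> * u ^ 3)"
    using \<kappa>(1,3) ru(2) unfolding B_def[symmetric] by (intro mult_right_mono) auto
  finally show ?thesis by (simp add: mult.assoc)
qed

lemma upper_tail_ge_moderate:
  assumes \<rho>: "0 < \<rho>" "\<rho> < 1" and ru: "real N = r ^ 3" "0 < r" "1 \<le> u" "6 * u / r \<le> min \<rho> (1 - \<rho>) / 2"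
  shows "exp (- 216 * (1 / \<rho> + 1 / (1 - \<rho>)) * u ^ 3) / 128 \<le> upper_tail \<rho> N (u\<^sup>2 * r)"
proof -
  interpret prob_space "stat_measure \<rho>" by (rule prob_space_stat_measure) fact+
  \<comment> \<open>The factor \<open>3\<close> makes \<open>N \<theta>\<^sup>3 / 3 = 9 u\<^sup>3\<close> exceed \<open>\<theta> u\<^sup>2 r = 3 u\<^sup>3\<close> by enough to absorb the
    constants when \<open>u \<ge> 1\<close>.\<close>
  define \<theta> where "\<theta> = 3 * u / r"
  define B where "B = 1 / \<rho> + 1 / (1 - \<rho>)"
  have \<theta>: "0 < \<theta>" "2 * \<theta> \<le> min \<rho> (1 - \<rho>) / 2"
    using ru by (auto simp: \<theta>_def)
  have N\<theta>: "real N * \<theta> ^ 3 = 27 * u ^ 3"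
    using ru by (simp add: \<theta>_def field_simps power3_eq_cube)
  have \<theta>t: "\<theta> * (u\<^sup>2 * r) = 3 * u ^ 3"
    using ru by (simp add: \<theta>_def power2_eq_square power3_eq_cube)
  have u: "1 \<le> u ^ 3" using ru by simp
  have "(8::real) \<le> exp 6"
    using exp_lower_Taylor_quadratic[of "6::real"] by simp
  also have "\<dots> \<le> exp (6 * u ^ 3)" using u by simp
  finally have e: "2 * exp (3 * u ^ 3) \<le> exp (9 * u ^ 3) / 4"
    using mult_right_mono[of 8 "exp (6 * u ^ 3)" "exp (3 * u ^ 3)"] by (simp flip: exp_add)
  have "(exp (9 * u ^ 3) / 4)\<^sup>2 / (4 * (2 * exp (B * (216 * u ^ 3)))) \<le> upper_tail \<rho> N (u\<^sup>2 * r)"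
  proof (rule exp_Paley_Zygmund[of _ \<theta>])
    show "ennreal (exp (9 * u ^ 3) / 4) \<le>
        (\<integral>\<^sup>+\<omega>. ennreal (exp (\<theta> * (G_stat \<omega> (char_point \<rho> N) - N))) \<partial>stat_measure \<rho>)"
      using moment_bounds(1)[OF \<rho>, of \<theta> N] \<theta> by (simp add: N\<theta>)
    show "2 * exp (\<theta> * (u\<^sup>2 * r)) \<le> exp (9 * u ^ 3) / 4"
      unfolding \<theta>t by (rule e)
    have N2\<theta>: "real N * (2 * \<theta>) ^ 3 = 216 * u ^ 3"
      using N\<theta> by (simp add: power_mult_distrib)
    show "(\<integral>\<^sup>+\<omega>. ennreal (exp (2 * \<theta> * (G_stat \<omega> (char_point \<rho> N) - N))) \<partial>stat_measure \<rho>) \<le>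
        ennreal (2 * exp (B * (216 * u ^ 3)))"
      using moment_bounds(2)[OF \<rho>, of "2 * \<theta>" N, unfolded N2\<theta>] \<theta> by (simp add: B_def)
  qed (use \<theta> ru in auto)
  also have "(exp (9 * u ^ 3) / 4)\<^sup>2 / (4 * (2 * exp (B * (216 * u ^ 3)))) =
      exp (18 * u ^ 3) * (exp (- 216 * B * u ^ 3) / 128)"
    by (simp add: power2_eq_square exp_minus field_simps flip: exp_add)
  finally have "exp (18 * u ^ 3) * (exp (- 216 * B * u ^ 3) / 128) \<le> upper_tail \<rho> N (u\<^sup>2 * r)" .
  moreover have "1 * (exp (- 216 * B * u ^ 3) / 128) \<le> exp (18 * u ^ 3) * (exp (- 216 * B * u ^ 3) / 128)"
    using ru(3) by (intro mult_right_mono) auto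
  ultimately show ?thesis unfolding B_def by linarith
qed

lemma upper_tail_antimono:
  assumes "0 < \<rho>" "\<rho> < 1" "s \<le> t"
  shows "upper_tail \<rho> N t \<le> upper_tail \<rho> N s"
proof -
  interpret prob_space "stat_measure \<rho>" by (rule prob_space_stat_measure) fact+
  show ?thesis
  proof (rule finite_measure_mono)
    show "{\<omega> \<in> space (stat_measure \<rho>). s \<le> G_stat \<omega> (char_point \<rho> N) - real N} \<in> sets (stat_measure \<rho>)"
      by measurable
  qed (use assms(3) in auto)
qed

text \<open>
  For deviations comparable to \<open>N\<close> the parameter \<open>\<theta>\<close> may leave the range in which the moments
  are finite. Here one boundary weight of size at least \<open>N + t\<close> suffices.
\<close>
lemma upper_tail_ge_large:
  assumes \<rho>: "0 < \<rho>" "\<rho> < 1" and "1 \<le> (1 - \<rho>)\<^sup>2 * real N" and "0 \<le> t" "t \<le> real N"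
  shows "exp (- 2 * real N) \<le> upper_tail \<rho> N t"
proof -
  obtain m n where mn: "char_point \<rho> N = (m, n)" by (cases "char_point \<rho> N")
  with assms(3) have "0 < m" by (auto simp: char_point_def le_floor_iff)
  have "exp (- 2 * real N) \<le> exp (- (1 - \<rho>) * (real N + t))"
  proof -
    have "(1 - \<rho>) * (real N + t) \<le> 1 * (2 * real N)"
      using assms by (intro mult_mono) auto
    then have "- 2 * real N \<le> - ((1 - \<rho>) * (real N + t))" by linarith
    then show ?thesis by (simp only: exp_le_cancel_iff mult_minus_left)
  qed
  also have "\<dots> \<le> upper_tail \<rho> N t"
    using prob_G_stat_ge_single_weight[OF \<rho> \<open>0 < m\<close>, of "real N + t" n] assms(4)
    by (simp add: mn algebra_simps)
  finally show ?thesis .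
qed

text \<open>
  The condition \<open>L u \<le> r\<close> is the range of \<open>upper_tail_ge_moderate\<close>. Beyond it
  \<open>N = r\<^sup>3 \<le> L\<^sup>3 u\<^sup>3\<close>, so the bound \<open>exp (- 2 N)\<close> is still exponential in \<open>u\<^sup>3\<close>; for \<open>u < 1\<close> the bound
  at \<open>u = 1\<close> gives the constant factor.
\<close>
lemma upper_tail_ge:
  assumes \<rho>: "0 < \<rho>" "\<rho> < 1" and ru: "real N = r ^ 3" "0 < u" "u \<le> r"
    and L: "L = 12 / min \<rho> (1 - \<rho>)" "L \<le> r"
    and B: "B = 216 * (1 / \<rho> + 1 / (1 - \<rho>))"
  shows "exp (- B) / 128 * exp (- (B + 2 * L ^ 3) * u ^ 3) \<le> upper_tail \<rho> N (u\<^sup>2 * r)"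
proof -
  define \<mu> where "\<mu> = min \<rho> (1 - \<rho>)"
  have \<mu>: "0 < \<mu>" "\<mu> \<le> 1 - \<rho>" "\<mu> \<le> 1" using \<rho> by (auto simp: \<mu>_def)
  have L\<mu>: "L * \<mu> = 12" using \<mu>(1) by (simp add: L(1) \<mu>_def[symmetric])
  have "0 \<le> L" using \<mu> by (simp add: L(1) \<mu>_def[symmetric])
  from mult_left_mono[OF \<mu>(3) this] L\<mu> have L0: "12 \<le> L" by simp
  have B0: "0 < B" using \<rho> by (simp add: B add_pos_pos)
  have moderate: "exp (- B * w ^ 3) / 128 \<le> upper_tail \<rho> N (w\<^sup>2 * r)" if "1 \<le> w" "L * w \<le> r" for w
  proof -
    have "12 * w \<le> \<mu> * r"
      using mult_left_mono[OF that(2), of \<mu>] \<mu> L\<mu> by (simp add: mult.assoc[symmetric] mult.commute[of \<mu> L])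
    then have "6 * w / r \<le> \<mu> / 2" using ru by (simp add: field_simps)
    then show ?thesis
      using upper_tail_ge_moderate[OF \<rho> ru(1), of w] that ru by (simp add: \<mu>_def B algebra_simps)
  qed
  have u3: "0 \<le> u ^ 3" using ru by simp
  consider "u < 1" | "1 \<le> u" "L * u \<le> r" | "1 \<le> u" "r < L * u" by linarith
  then show ?thesis
  proof cases
    case 1
    have "0 \<le> (B + 2 * L ^ 3) * u ^ 3"
      using B0 L0 u3 by (intro mult_nonneg_nonneg add_nonneg_nonneg) auto
    then have "exp (- (B + 2 * L ^ 3) * u ^ 3) \<le> 1"
      by (simp only: exp_le_one_iff mult_minus_left neg_le_0_iff_le)
    then have "exp (- B) / 128 * exp (- (B + 2 * L ^ 3) * u ^ 3) \<le> exp (- B) / 128 * 1"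
      by (rule mult_left_mono) simp
    also have "\<dots> \<le> upper_tail \<rho> N (1\<^sup>2 * r)"
      using moderate[of 1] L by simp
    also have "\<dots> \<le> upper_tail \<rho> N (u\<^sup>2 * r)"
      using \<rho> ru 1 by (intro upper_tail_antimono mult_right_mono) (auto simp: power_le_one)
    finally show ?thesis .
  next
    case 2
    have "B * u ^ 3 \<le> (B + 2 * L ^ 3) * u ^ 3"
      using L0 u3 by (intro mult_right_mono) auto
    then have "exp (- (B + 2 * L ^ 3) * u ^ 3) \<le> exp (- B * u ^ 3)"
      by (simp only: exp_le_cancel_iff mult_minus_left neg_le_iff_le)
    then have "exp (- B) / 128 * exp (- (B + 2 * L ^ 3) * u ^ 3) \<le> 1 / 128 * exp (- B * u ^ 3)"
      using B0 by (intro mult_mono) auto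
    also have "\<dots> \<le> upper_tail \<rho> N (u\<^sup>2 * r)"
      using moderate[of u] 2 by simp
    finally show ?thesis .
  next
    case 3
    have "r ^ 3 \<le> (L * u) ^ 3" using 3 ru by (intro power_mono) auto
    then have N: "real N \<le> L ^ 3 * u ^ 3" by (simp add: ru power_mult_distrib)
    have "0 \<le> B * u ^ 3" using B0 u3 by simp
    with N have "2 * real N \<le> (B + 2 * L ^ 3) * u ^ 3"
      by (simp add: distrib_right)
    then have "exp (- (B + 2 * L ^ 3) * u ^ 3) \<le> exp (- 2 * real N)"
      by (simp only: exp_le_cancel_iff mult_minus_left neg_le_iff_le)
    moreover have "exp (- B) \<le> 1" using B0 by simp
    then have "exp (- B) / 128 \<le> 1" by linarith
    ultimately have "exp (- B) / 128 * exp (- (B + 2 * L ^ 3) * u ^ 3) \<le> 1 * exp (- 2 * real N)"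
      by (intro mult_mono) auto
    also have "\<dots> \<le> upper_tail \<rho> N (u\<^sup>2 * r)"
    proof -
      have "1 \<le> (\<mu> * L)\<^sup>2 * L" using L0 L\<mu> by (simp add: mult.commute)
      also have "\<dots> = \<mu>\<^sup>2 * L ^ 3" by (simp add: power2_eq_square power3_eq_cube)
      also have "\<dots> \<le> (1 - \<rho>)\<^sup>2 * r ^ 3"
        using \<rho> \<mu> L L0 by (intro mult_mono power_mono) auto
      finally have "1 \<le> (1 - \<rho>)\<^sup>2 * real N" by (simp add: ru)
      moreover have "u\<^sup>2 * r \<le> r\<^sup>2 * r"
        using ru by (intro mult_right_mono power_mono) auto
      then have "u\<^sup>2 * r \<le> real N" by (simp add: ru power2_eq_square power3_eq_cube)
      ultimately have "exp (- 2 * real N) \<le> upper_tail \<rho> N (u\<^sup>2 * r)"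
        using ru by (intro upper_tail_ge_large[OF \<rho>]) auto
      then show ?thesis by simp
    qed
    finally show ?thesis .
  qed
qed

theorem theorem2p5:
  fixes \<rho> \<delta>\<^sub>1 :: real
  assumes "0 < \<rho>" "\<rho> < 1" and "0 < \<delta>\<^sub>1" "\<delta>\<^sub>1 < 1"
  shows
    "(\<exists>(C::real) (c::real) (N\<^sub>0::nat). C > 0 \<and> c > 0 \<and> N\<^sub>0 > 0 \<and>
        (\<forall>N\<ge>N\<^sub>0. \<forall>y::real. 0 < y \<and> y < \<delta>\<^sub>1 * real N powr (2/3) \<longrightarrow>
          measure (stat_measure \<rho>)
              {\<omega> \<in> space (stat_measure \<rho>).
                 G_stat \<omega> (char_point \<rho> N) - real N \<ge> y * real N powr (1/3)}
            \<le> C * exp (- c * y powr (3/2))))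
     \<and>
     (\<exists>(C::real) (c::real) (N\<^sub>0::nat). C > 0 \<and> c > 0 \<and> N\<^sub>0 > 0 \<and>
        (\<forall>N\<ge>N\<^sub>0. \<forall>y::real. 0 < y \<and> y < \<delta>\<^sub>1 * real N powr (2/3) \<longrightarrow>
          measure (stat_measure \<rho>)
              {\<omega> \<in> space (stat_measure \<rho>).
                 G_stat \<omega> (char_point \<rho> N) - real N \<ge> y * real N powr (1/3)}
            \<ge> C * exp (- c * y powr (3/2))))"
proof -
  have u_le_r: "sqrt y \<le> real N powr (1/3)"
    if "0 < N" "0 < y" "y < \<delta>\<^sub>1 * real N powr (2/3)" for N y
  proof -
    have "\<delta>\<^sub>1 * real N powr (2/3) \<le> 1 * real N powr (2/3)"
      using assms by (intro mult_right_mono) auto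
    with that have "y \<le> real N powr (2/3)" by linarith
    also have "\<dots> = (real N powr (1/3))\<^sup>2"
      using that by (intro cube_root_scaling(4))
    finally show ?thesis by (intro real_le_lsqrt) auto
  qed
  define B where "B = 1 / \<rho> + 1 / (1 - \<rho>)"
  have B: "0 < B" using assms by (simp add: B_def add_pos_pos)
  define \<kappa> where "\<kappa> = min (min \<rho> (1 - \<rho>) / 2) (sqrt (1 / (2 * B)))"
  have \<kappa>: "0 < \<kappa>" "\<kappa> \<le> min \<rho> (1 - \<rho>) / 2" "\<kappa> \<le> sqrt (1 / (2 * B))"
    unfolding \<kappa>_def by (simp add: assms B, rule min.cobounded1, rule min.cobounded2)
  have "\<kappa>\<^sup>2 \<le> (sqrt (1 / (2 * B)))\<^sup>2"
    using \<kappa> by (intro power_mono) auto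
  then have \<kappa>2: "B * \<kappa>\<^sup>2 \<le> 1 / 2" using B by (simp add: field_simps)
  define L where "L = 12 / min \<rho> (1 - \<rho>)"
  have L: "0 < L" using assms by (simp add: L_def)
  have upper: "upper_tail \<rho> N (y * real N powr (1/3)) \<le> 2 * exp (- (\<kappa> / 2) * y powr (3/2))"
    if "1 \<le> N" "0 < y" "y < \<delta>\<^sub>1 * real N powr (2/3)" for N y
    using upper_tail_le[OF assms(1,2), of N "real N powr (1/3)" "sqrt y" \<kappa>]
      cube_root_scaling[of N y] u_le_r[of N y] that \<kappa> \<kappa>2 by (simp add: B_def)
  have lower: "exp (- (216 * B)) / 128 * exp (- (216 * B + 2 * L ^ 3) * y powr (3/2)) \<le>
      upper_tail \<rho> N (y * real N powr (1/3))"
    if "nat \<lceil>L ^ 3\<rceil> + 1 \<le> N" "0 < y" "y < \<delta>\<^sub>1 * real N powr (2/3)" for N y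
  proof -
    have N: "0 < N" using that by simp
    have "L ^ 3 \<le> (real N powr (1/3)) ^ 3"
      using that(1) cube_root_scaling(3)[OF N that(2), symmetric] by linarith
    then have "L \<le> real N powr (1/3)" by (rule power_le_imp_le_base[of _ 2, simplified]) auto
    with upper_tail_ge[OF assms(1,2), of N "real N powr (1/3)" "sqrt y" L "216 * B"]
    show ?thesis
      using cube_root_scaling[OF N that(2)] u_le_r[OF N that(2,3)] by (simp add: B_def L_def)
  qed
  show ?thesis
  proof (intro conjI)
    show "\<exists>(C::real) (c::real) (N\<^sub>0::nat). C > 0 \<and> c > 0 \<and> N\<^sub>0 > 0 \<and>
        (\<forall>N\<ge>N\<^sub>0. \<forall>y::real. 0 < y \<and> y < \<delta>\<^sub>1 * real N powr (2/3) \<longrightarrow>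
          upper_tail \<rho> N (y * real N powr (1/3)) \<le> C * exp (- c * y powr (3/2)))"
      using upper \<kappa> by (intro exI[of _ 2] exI[of _ "\<kappa> / 2"] exI[of _ 1]) auto
    show "\<exists>(C::real) (c::real) (N\<^sub>0::nat). C > 0 \<and> c > 0 \<and> N\<^sub>0 > 0 \<and>
        (\<forall>N\<ge>N\<^sub>0. \<forall>y::real. 0 < y \<and> y < \<delta>\<^sub>1 * real N powr (2/3) \<longrightarrow>
          upper_tail \<rho> N (y * real N powr (1/3)) \<ge> C * exp (- c * y powr (3/2)))"
      using lower B L by (intro exI[of _ "exp (- (216 * B)) / 128"] exI[of _ "216 * B + 2 * L ^ 3"]
          exI[of _ "nat \<lceil>L ^ 3\<rceil> + 1"]) (auto intro!: add_pos_pos)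
  qed
qed

end
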